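(* Let $\epsilon>0$ and let $m$ be a fixed positive integer. If $\{u_t\}$ is a sequence of i.i.d. real random variables, then, as $T\to\infty$, $$\frac{C_{m,T}(\epsilon)-\mu_m}{\sigma_m}\stackrel{D}{\longrightarrow}N(0,1),$$ where $$\mu_m=\mathbf{E}\,C_{m,T}(\epsilon)=\frac1N\sum_{k=1}^{m-1}(T_m-k)W_m(k,0)+\frac{N_0}{N}W_m(m,0),$$ $$\sigma_m^2=\breve\sigma_m^2+\Big(\frac{N_0}{N}\Big)^2\widetilde\sigma_m^2,$$ with $\widetilde\sigma_m^2$ as described in the context, and $$\begin{aligned}\breve\sigma_m^2=\frac{2}{N^2}\sum_{k=1}^{m-1}\mathcal M_{T,m}(k)\Big\{&2\sum_{d_1=1}^m\big[W_m(k,d_1)-W_m(k,0)W_m(m,0)\big]\\ &+[1-I_0(k-2i)]\Big[\sum_{d_2=1}^{i}U_m(k,d_2)+(k-2i)U_m(k,i)+\sum_{d_2=k-i+1}^{k-1}U_m(k,k-d_2)\Big]\\ &+I_0(k-2i)\Big[\sum_{d_2=1}^{k-i}U_m(k,d_2)+(2i-k)U_m(k,k-i)+\sum_{d_2=i+1}^{k-1}U_m(k,k-d_2)\Big]\Big\},\end{aligned}$$ where $\mathcal M_{T,m}(k)=(T-4m-k+3)(T-4m-k+4)$, $h=\lfloor m/k\rfloor$ and $i=m-hk$ (both depending on $k$).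
   Context: Observations $u_1,\dots,u_T$ are given; $m$ and $\epsilon>0$ are fixed. $T_m=T-m+1$, $N=\binom{T_m}{2}$, $N_0=\binom{T_m-m+1}{2}$. $Y_l^m=(u_l,u_{l+1},\dots,u_{l+m-1})'$ for $1\le l\le T_m$; $\|\cdot\|$ is the maximum norm; $I_a(x)=1$ if $x<a$ and $0$ otherwise (used with $a=\epsilon$ and $a=0$). Empty sums are $0$. $\stackrel{D}{\longrightarrow}$ is weak convergence. The correlation integral is $C_{m,T}(\epsilon)=\frac1N\sum_{1\le t<s\le T_m}I_\epsilon(\|Y_t^m-Y_s^m\|)$. Also $\widetilde C_{m,T}(\epsilon)=\frac{1}{N_0}\sum_{t=1}^{T_m-m}\sum_{s=t+m}^{T_m}I_\epsilon(\|Y_t^m-Y_s^m\|)$. Probabilities. Let $v_0,v_1,\dots,w_1,w_2,\dots$ be i.i.d. with the law of $u_1$. - $\omega_l^r=P\big(|v_j-v_{j+1}|<\epsilon\ (0\le j\le l-1),\ |v_{l-r+j}-w_j|<\epsilon\ (1\le j\le r)\big)$ for $0\le r\le l+1$. - $\eta_l^{l-1}=P\big(|v_j-v_{j+1}|<\epsilon\ (0\le j\le l),\ |v_j-w_j|<\epsilon\ (1\le j\le l-1)\big)$. For positive integers $k\le m$ and integer $d\ge0$, put $h=\lfloor m/k\rfloor$, $i=m-hk$, $r=\lfloor d/k\rfloor$, $\tau=d-rk$, and $$W_m(k,d)=(\omega_{h+1}^{r+1})^{\tau}(\omega_{h+1}^{r})^{i-\tau}(\omega_h^{r})^{k-i}\big(1-I_0(i-\tau)\big)+(\omega_{h+1}^{r+1})^{i}(\omega_h^{r+1})^{d-rk-i}(\omega_h^{r})^{k-d+rk}I_0(i-\tau),$$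 $$U_m(k,d)=(\omega_{h+1}^{h+1})^{i-d}(\eta_{h+1}^{h})^{d}(\omega_h^{h+1})^{d}(\omega_h^{h})^{k-i-d}-W_m(k,0)W_m(m,0).$$ In particular $W_m(k,0)=(\omega_h^0)^{k-i}(\omega_{h+1}^0)^i$ and $W_m(m,0)=(\omega_1^0)^m$. The quantity $\widetilde\sigma_m^2$ is the asymptotic variance of $\widetilde C_{m,T}(\epsilon)$ including all terms of order $T^{-1}$ and $T^{-2}$; that is, it is a deterministic quantity (depending on $T$, $m$, $\epsilon$ and the law of $u_1$) with $\mathbf{Var}(\widetilde C_{m,T}(\epsilon))=\widetilde\sigma_m^2+O(T^{-3})$.
   Formalization: Adds the assumption $\omega_2^0\neq(\omega_1^0)^2$, i.e. $P(|x-u_1|<\epsilon)$ at $x=u_2$ is not a.s. constant; without it the claim fails, e.g. $m=1$, $u_t=\pm1$ with probability 1/2, $\epsilon\le2$, where the limit is $(Z^2-1)/\sqrt2$. *)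

theory Defs
  imports "HOL-Probability.Probability" "HOL-Library.Landau_Symbols"
begin

section \<open>Correlation integrals of a real sequence\<close>

definition Ind :: "real \<Rightarrow> real \<Rightarrow> real" where
  "Ind a x = indicator {..<a} x"

text \<open>A vector of length \<open>m\<close> is a function on \<open>{..<m}\<close>; only \<open>m > 0\<close> is used, since
  \<open>Max {}\<close> is unspecified.\<close>

definition max_norm :: "nat \<Rightarrow> (nat \<Rightarrow> real) \<Rightarrow> real" where
  "max_norm m y = Max ((\<lambda>j. \<bar>y j\<bar>) ` {..<m})"

definition delay_vec :: "(nat \<Rightarrow> real) \<Rightarrow> nat \<Rightarrow> nat \<Rightarrow> real" where
  "delay_vec x l = (\<lambda>j. x (l + j))"

definition close_vec :: "nat \<Rightarrow> real \<Rightarrow> (nat \<Rightarrow> real) \<Rightarrow> nat \<Rightarrow> nat \<Rightarrow> real" where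
  "close_vec m \<epsilon> x t s = Ind \<epsilon> (max_norm m (\<lambda>j. delay_vec x t j - delay_vec x s j))"

text \<open>The truncated subtractions below agree with the integer ones as soon as \<open>2 * m \<le> T\<close>.\<close>

definition num_vec :: "nat \<Rightarrow> nat \<Rightarrow> nat" where
  "num_vec m T = T + 1 - m"

definition num_pairs :: "nat \<Rightarrow> nat \<Rightarrow> real" where
  "num_pairs m T = real (num_vec m T choose 2)"

definition num_pairs0 :: "nat \<Rightarrow> nat \<Rightarrow> real" where
  "num_pairs0 m T = real ((num_vec m T + 1 - m) choose 2)"

text \<open>The observations are \<open>x 1, \<dots>, x T\<close>; the value \<open>x 0\<close> is never used.\<close>

definition corr_int :: "nat \<Rightarrow> real \<Rightarrow> nat \<Rightarrow> (nat \<Rightarrow> real) \<Rightarrow> real" where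
  "corr_int m \<epsilon> T x =
     1 / num_pairs m T * (\<Sum>t = 1..num_vec m T. \<Sum>s\<in>{t<..num_vec m T}. close_vec m \<epsilon> x t s)"

definition corr_int0 :: "nat \<Rightarrow> real \<Rightarrow> nat \<Rightarrow> (nat \<Rightarrow> real) \<Rightarrow> real" where
  "corr_int0 m \<epsilon> T x =
     1 / num_pairs0 m T *
       (\<Sum>t = 1..num_vec m T - m. \<Sum>s = t + m..num_vec m T. close_vec m \<epsilon> x t s)"

section \<open>Chain probabilities\<close>

text \<open>\<open>D\<close> is the common law. The i.i.d. families \<open>v\<close> and \<open>w\<close> are the two coordinate processes
  of a product space; the coordinate \<open>w 0\<close> is never used.\<close>

abbreviation iid_pair :: "real measure \<Rightarrow> ((nat \<Rightarrow> real) \<times> (nat \<Rightarrow> real)) measure" where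
  "iid_pair D \<equiv> (\<Pi>\<^sub>M n\<in>(UNIV :: nat set). D) \<Otimes>\<^sub>M (\<Pi>\<^sub>M n\<in>(UNIV :: nat set). D)"

text \<open>\<open>omega D \<epsilon> l r\<close> has subscript \<open>l\<close> and superscript \<open>r\<close>, with \<open>r \<le> l + 1\<close>. The index
  \<open>l + j - r\<close> is \<open>l - r + j\<close> written so that truncated subtraction is harmless.\<close>

definition omega :: "real measure \<Rightarrow> real \<Rightarrow> nat \<Rightarrow> nat \<Rightarrow> real" where
  "omega D \<epsilon> l r =
     \<P>(p in iid_pair D.
         (\<forall>j<l. \<bar>fst p j - fst p (j + 1)\<bar> < \<epsilon>) \<and>
         (\<forall>j\<in>{1..r}. \<bar>fst p (l + j - r) - snd p j\<bar> < \<epsilon>))"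

text \<open>\<open>eta D \<epsilon> l\<close> has subscript \<open>l\<close> and superscript \<open>l - 1\<close>.\<close>

definition eta :: "real measure \<Rightarrow> real \<Rightarrow> nat \<Rightarrow> real" where
  "eta D \<epsilon> l =
     \<P>(p in iid_pair D.
         (\<forall>j\<le>l. \<bar>fst p j - fst p (j + 1)\<bar> < \<epsilon>) \<and>
         (\<forall>j\<in>{1..l - 1}. \<bar>fst p j - snd p j\<bar> < \<epsilon>))"

section \<open>Mean and variance\<close>

text \<open>In \<open>W\<close> and \<open>U\<close> some exponents are truncated subtractions. In \<open>W\<close> an exponent that would
  be negative occurs only in a summand multiplied by 0; in \<open>sigma_breve2\<close> this happens for \<open>U\<close>
  only inside the bracket multiplied by 0.\<close>

definition W :: "real measure \<Rightarrow> real \<Rightarrow> nat \<Rightarrow> nat \<Rightarrow> nat \<Rightarrow> real" where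
  "W D \<epsilon> m k d =
     (let h = m div k; i = m - h * k; r = d div k; \<tau> = d - r * k in
        omega D \<epsilon> (h + 1) (r + 1) ^ \<tau> * omega D \<epsilon> (h + 1) r ^ (i - \<tau>) *
          omega D \<epsilon> h r ^ (k - i) * (1 - Ind 0 (real i - real \<tau>))
      + omega D \<epsilon> (h + 1) (r + 1) ^ i * omega D \<epsilon> h (r + 1) ^ (\<tau> - i) *
          omega D \<epsilon> h r ^ (k - \<tau>) * Ind 0 (real i - real \<tau>))"

definition U :: "real measure \<Rightarrow> real \<Rightarrow> nat \<Rightarrow> nat \<Rightarrow> nat \<Rightarrow> real" where
  "U D \<epsilon> m k d =
     (let h = m div k; i = m - h * k in
        omega D \<epsilon> (h + 1) (h + 1) ^ (i - d) * eta D \<epsilon> (h + 1) ^ d *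
          omega D \<epsilon> h (h + 1) ^ d * omega D \<epsilon> h h ^ (k - i - d)
      - W D \<epsilon> m k 0 * W D \<epsilon> m m 0)"

definition mu :: "real measure \<Rightarrow> real \<Rightarrow> nat \<Rightarrow> nat \<Rightarrow> real" where
  "mu D \<epsilon> m T =
     1 / num_pairs m T * (\<Sum>k = 1..m - 1. (real (num_vec m T) - real k) * W D \<epsilon> m k 0)
     + num_pairs0 m T / num_pairs m T * W D \<epsilon> m m 0"

definition M_weight :: "nat \<Rightarrow> nat \<Rightarrow> nat \<Rightarrow> real" where
  "M_weight T m k =
     (real T - 4 * real m - real k + 3) * (real T - 4 * real m - real k + 4)"

definition sigma_breve2 :: "real measure \<Rightarrow> real \<Rightarrow> nat \<Rightarrow> nat \<Rightarrow> real" where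
  "sigma_breve2 D \<epsilon> m T =
     2 / (num_pairs m T)\<^sup>2 *
     (\<Sum>k = 1..m - 1. M_weight T m k *
        (let i = m - (m div k) * k in
           2 * (\<Sum>d = 1..m. W D \<epsilon> m k d - W D \<epsilon> m k 0 * W D \<epsilon> m m 0)
           + (1 - Ind 0 (real k - 2 * real i)) *
               ((\<Sum>d = 1..i. U D \<epsilon> m k d)
                + (real k - 2 * real i) * U D \<epsilon> m k i
                + (\<Sum>d = k - i + 1..k - 1. U D \<epsilon> m k (k - d)))
           + Ind 0 (real k - 2 * real i) *
               ((\<Sum>d = 1..k - i. U D \<epsilon> m k d)
                + (2 * real i - real k) * U D \<epsilon> m k (k - i)
                + (\<Sum>d = i + 1..k - 1. U D \<epsilon> m k (k - d)))))"

text \<open>\<open>s2\<close> stands for the asymptotic variance of \<open>corr_int0\<close>, as a function of \<open>T\<close>.\<close>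

definition sigma2 :: "real measure \<Rightarrow> real \<Rightarrow> nat \<Rightarrow> (nat \<Rightarrow> real) \<Rightarrow> nat \<Rightarrow> real" where
  "sigma2 D \<epsilon> m s2 T =
     sigma_breve2 D \<epsilon> m T + (num_pairs0 m T / num_pairs m T)\<^sup>2 * s2 T"

end

theory Submission
  imports Defs "HOL-Real_Asymp.Real_Asymp"
begin

text \<open>
  Up to normalisation the correlation integral is a U-statistic in the delay vectors, which
  overlap and therefore form an \<open>m\<close>-dependent sequence. Let \<open>n = T - m + 1\<close>, let \<open>N\<close> be the number
  of pairs, \<open>F x = P(\<bar>x - v\<bar> < \<epsilon>)\<close> for \<open>v\<close> with the common law, \<open>c = E F\<close> and \<open>K = E F\<^sup>2\<close>.
  For two delay vectors without a common observation the closeness indicator \<open>h a b\<close> has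
  the Hoeffding decomposition \<open>h a b - c^m = R a b + X a + X b\<close>, where \<open>X a\<close> is the centred product of
  \<open>F\<close> over the \<open>a\<close>-th window and \<open>R a b\<close> integrates to zero over either of its two windows.
  Hence \<open>R a b\<close> and \<open>R a' b'\<close> are uncorrelated unless \<open>a'\<close> and \<open>b'\<close> both have distance below \<open>m\<close> from
  \<open>a\<close> or \<open>b\<close>. Each pair has boundedly many such partners, so the sum of \<open>R\<close> over the
  \<open>O(n\<^sup>2)\<close> distant pairs has second moment \<open>O(n\<^sup>2)\<close>. The pairs at distance below \<open>m\<close> number \<open>O(n)\<close>,
  so \<open>2 N (C - \<mu>) = 2 n S n + O(n)\<close> in mean square, with \<open>S n = X 1 + \<dots> + X n\<close>
  (lemmas \<open>far_sum_projection\<close>, \<open>pair_sum_projection\<close>).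

  The covariances of \<open>X\<close> can be computed: at lag \<open>d\<close> they are
  \<open>\<gamma> d = K^(m - d) * c^(2 * min d m) - c^(2 * m)\<close>. They are nonnegative, vanish from lag \<open>m\<close> on, and
  \<open>\<gamma> 0 > 0\<close> because \<open>K \<noteq> c\<^sup>2\<close>; the numbers \<open>c\<close> and \<open>K\<close> are the two chain probabilities in the
  nondegeneracy assumption. So \<open>E (S n)\<^sup>2\<close> grows like \<open>n v\<close> with \<open>v > 0\<close>. Sums over blocks
  of a fixed length \<open>L\<close> separated by gaps of length \<open>m\<close> are i.i.d., which gives the central limit theorem for
  \<open>S n / sqrt (n v)\<close> when first \<open>n\<close> and then \<open>L\<close> tends to infinity (theorem \<open>clt_S\<close>). All passages to
  simpler statistics go through characteristic functions: variables that are close in mean square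
  have close characteristic functions (lemma \<open>weak_conv_m_L2_approx\<close>).

  It remains to identify the normalisation. The same approximation shows
  \<open>T Var(C\<^sub>0) \<longlonglongrightarrow> 4 v\<close> for the variant \<open>C\<^sub>0\<close> of the correlation integral over distant pairs, hence
  \<open>T \<sigma>\<^sub>0\<^sup>2 \<longlonglongrightarrow> 4 v\<close> for its asymptotic variance \<open>\<sigma>\<^sub>0\<^sup>2\<close>. The summand \<open>sigma_breve2\<close> is \<open>O(1 / T\<^sup>2)\<close>, since
  it consists of finitely many constants weighted by \<open>M_weight T m k / (num_pairs m T)\<^sup>2\<close>. So \<open>\<sigma>\<^sup>2\<close> is asymptotic to
  \<open>4 v / T\<close>, which is the variance of \<open>2 n S n / (2 N)\<close> to first order.

  The mean is exact. At a lag \<open>q < m\<close> the \<open>m\<close> inequalities between two delay vectors split along the residue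
  classes modulo \<open>q\<close> into \<open>q\<close> chains on disjoint sets of observations, of length \<open>m div q + 1\<close> for the first
  \<open>m mod q\<close> classes and \<open>m div q\<close> for the others (lemma \<open>expectation_h_lag\<close>); from lag \<open>m\<close> on the probability is \<open>c^m\<close>.
\<close>

section \<open>Weak convergence and mean-square approximation\<close>

lemma cmod_iexp_diff_le: "cmod (iexp x - iexp y) \<le> \<bar>x - y\<bar>"
proof -
  have "iexp x - iexp y = iexp y * (iexp (x - y) - 1)"
    by (simp add: algebra_simps flip: exp_add)
  also have "cmod \<dots> = cmod (iexp (x - y) - 1)"
    by (simp add: norm_mult)
  also have "\<dots> \<le> \<bar>x - y\<bar>"
    using iexp_approx1[of "x - y" 0] by simp
  finally show ?thesis .
qed

text \<open>The variance of \<open>\<bar>Z\<bar>\<close> is nonnegative.\<close>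

lemma (in prob_space) expectation_abs_le_sqrt:
  fixes Z :: "'a \<Rightarrow> real"
  assumes [measurable]: "random_variable borel Z" and sq: "integrable M (\<lambda>\<omega>. (Z \<omega>)\<^sup>2)"
  shows "integrable M Z" "expectation (\<lambda>\<omega>. \<bar>Z \<omega>\<bar>) \<le> sqrt (expectation (\<lambda>\<omega>. (Z \<omega>)\<^sup>2))"
proof -
  show int: "integrable M Z"
    by (rule square_integrable_imp_integrable[OF _ sq]) simp
  have "0 \<le> variance (\<lambda>\<omega>. \<bar>Z \<omega>\<bar>)" by (rule variance_positive)
  also have "\<dots> = expectation (\<lambda>\<omega>. (Z \<omega>)\<^sup>2) - (expectation (\<lambda>\<omega>. \<bar>Z \<omega>\<bar>))\<^sup>2"
    using int sq by (subst variance_eq) auto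
  finally show "expectation (\<lambda>\<omega>. \<bar>Z \<omega>\<bar>) \<le> sqrt (expectation (\<lambda>\<omega>. (Z \<omega>)\<^sup>2))"
    by (intro real_le_rsqrt) simp
qed

text \<open>The function \<open>x \<mapsto> exp (\<i> \<theta> x)\<close> is Lipschitz with constant \<open>\<bar>\<theta>\<bar>\<close>, and the first absolute moment
  is at most the root of the second moment. This is the only link between mean-square estimates and weak convergence.\<close>

lemma (in prob_space) char_diff_le_L2:
  fixes X Y :: "'a \<Rightarrow> real"
  assumes [measurable]: "random_variable borel X" "random_variable borel Y"
    and sq: "integrable M (\<lambda>\<omega>. (X \<omega> - Y \<omega>)\<^sup>2)"
  shows "cmod (char (distr M borel X) \<theta> - char (distr M borel Y) \<theta>)
    \<le> \<bar>\<theta>\<bar> * sqrt (expectation (\<lambda>\<omega>. (X \<omega> - Y \<omega>)\<^sup>2))"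
proof -
  have int: "integrable M (\<lambda>\<omega>. X \<omega> - Y \<omega>)"
    and le: "expectation (\<lambda>\<omega>. \<bar>X \<omega> - Y \<omega>\<bar>) \<le> sqrt (expectation (\<lambda>\<omega>. (X \<omega> - Y \<omega>)\<^sup>2))"
    using expectation_abs_le_sqrt[OF _ sq] by simp_all
  have I: "integrable M (\<lambda>\<omega>. iexp (\<theta> * Z \<omega>))" if [measurable]: "random_variable borel Z" for Z
    by (rule integrable_const_bound[of _ 1]) auto
  have "char (distr M borel X) \<theta> - char (distr M borel Y) \<theta>
      = (CLINT \<omega>|M. iexp (\<theta> * X \<omega>)) - (CLINT \<omega>|M. iexp (\<theta> * Y \<omega>))"
    by (simp add: char_def integral_distr)
  also have "\<dots> = (CLINT \<omega>|M. iexp (\<theta> * X \<omega>) - iexp (\<theta> * Y \<omega>))"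
    by (rule Bochner_Integration.integral_diff[symmetric]; rule I) simp_all
  also have "cmod \<dots> \<le> expectation (\<lambda>\<omega>. cmod (iexp (\<theta> * X \<omega>) - iexp (\<theta> * Y \<omega>)))"
    by (rule Bochner_Integration.integral_norm_bound)
  also have "\<dots> \<le> expectation (\<lambda>\<omega>. \<bar>\<theta>\<bar> * \<bar>X \<omega> - Y \<omega>\<bar>)"
  proof (rule Bochner_Integration.integral_mono)
    show "integrable M (\<lambda>\<omega>. cmod (iexp (\<theta> * X \<omega>) - iexp (\<theta> * Y \<omega>)))"
      by (intro Bochner_Integration.integrable_norm Bochner_Integration.integrable_diff I) simp_all
    show "integrable M (\<lambda>\<omega>. \<bar>\<theta>\<bar> * \<bar>X \<omega> - Y \<omega>\<bar>)" using int by simp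
    show "cmod (iexp (\<theta> * X \<omega>) - iexp (\<theta> * Y \<omega>)) \<le> \<bar>\<theta>\<bar> * \<bar>X \<omega> - Y \<omega>\<bar>" for \<omega>
      using cmod_iexp_diff_le[of "\<theta> * X \<omega>" "\<theta> * Y \<omega>"]
      by (simp add: abs_mult flip: right_diff_distrib)
  qed
  also have "\<dots> \<le> \<bar>\<theta>\<bar> * sqrt (expectation (\<lambda>\<omega>. (X \<omega> - Y \<omega>)\<^sup>2))"
    using le by (simp add: mult_left_mono)
  finally show ?thesis .
qed

text \<open>A Slutsky-type principle by the continuity theorem. The approximating sequence may depend on
  the accuracy \<open>\<delta>\<close>; the block argument for sums of dependent variables uses this freedom to fix the block length
  before the sample size grows.\<close>

lemma (in prob_space) weak_conv_m_L2_approx: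
  fixes Z :: "nat \<Rightarrow> 'a \<Rightarrow> real"
  assumes Z: "\<And>n. random_variable borel (Z n)" and N: "real_distribution N"
    and approx: "\<And>\<delta>. \<delta> > 0 \<Longrightarrow> \<exists>W. (\<forall>n. random_variable borel (W n)) \<and>
        weak_conv_m (\<lambda>n. distr M borel (W n)) N \<and>
        (\<forall>\<^sub>F n in sequentially. integrable M (\<lambda>\<omega>. (Z n \<omega> - W n \<omega>)\<^sup>2) \<and>
           expectation (\<lambda>\<omega>. (Z n \<omega> - W n \<omega>)\<^sup>2) \<le> \<delta>)"
  shows "weak_conv_m (\<lambda>n. distr M borel (Z n)) N"
proof (rule levy_continuity)
  show "real_distribution (distr M borel (Z n))" for n
    using Z by (rule real_distribution_distr)
  fix \<theta> :: real
  show "(\<lambda>n. char (distr M borel (Z n)) \<theta>) \<longlonglongrightarrow> char N \<theta>"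
  proof (rule tendstoI)
    fix e :: real assume e: "e > 0"
    define \<delta> where "\<delta> = (e / (2 * (\<bar>\<theta>\<bar> + 1)))\<^sup>2"
    have "\<delta> > 0" using e by (auto simp: \<delta>_def)
    then obtain W where W: "\<And>n. random_variable borel (W n)"
        and conv: "weak_conv_m (\<lambda>n. distr M borel (W n)) N"
        and ev: "\<forall>\<^sub>F n in sequentially. integrable M (\<lambda>\<omega>. (Z n \<omega> - W n \<omega>)\<^sup>2) \<and>
           expectation (\<lambda>\<omega>. (Z n \<omega> - W n \<omega>)\<^sup>2) \<le> \<delta>"
      using approx[of \<delta>] by blast
    have "(\<lambda>n. char (distr M borel (W n)) \<theta>) \<longlonglongrightarrow> char N \<theta>"
      by (rule levy_continuity1[OF _ N conv]) (rule real_distribution_distr[OF W])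
    then have "\<forall>\<^sub>F n in sequentially. dist (char (distr M borel (W n)) \<theta>) (char N \<theta>) < e / 2"
      using e by (intro tendstoD) auto
    with ev show "\<forall>\<^sub>F n in sequentially. dist (char (distr M borel (Z n)) \<theta>) (char N \<theta>) < e"
    proof eventually_elim
      case (elim n)
      have "cmod (char (distr M borel (Z n)) \<theta> - char (distr M borel (W n)) \<theta>)
          \<le> \<bar>\<theta>\<bar> * sqrt (expectation (\<lambda>\<omega>. (Z n \<omega> - W n \<omega>)\<^sup>2))"
        using elim by (intro char_diff_le_L2 Z W) auto
      also have "\<dots> \<le> \<bar>\<theta>\<bar> * sqrt \<delta>"
        using elim by (intro mult_left_mono) auto
      also have "\<dots> = \<bar>\<theta>\<bar> / (\<bar>\<theta>\<bar> + 1) * (e / 2)"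
        using e by (simp add: \<delta>_def)
      also have "\<dots> \<le> 1 * (e / 2)"
        using e by (intro mult_right_mono) auto
      finally have "dist (char (distr M borel (Z n)) \<theta>) (char (distr M borel (W n)) \<theta>) \<le> e / 2"
        by (simp add: dist_norm)
      with elim show ?case
        using dist_triangle[of "char (distr M borel (Z n)) \<theta>" "char N \<theta>" "char (distr M borel (W n)) \<theta>"]
        by linarith
    qed
  qed
qed (rule N)

lemma weak_conv_m_filterlim:
  assumes "weak_conv_m \<mu> N" "filterlim f at_top sequentially"
  shows "weak_conv_m (\<lambda>n. \<mu> (f n)) N"
  unfolding weak_conv_m_def weak_conv_def
proof (intro allI impI)
  fix x assume "isCont (cdf N) x"
  then have "(\<lambda>n. cdf (\<mu> n) x) \<longlonglongrightarrow> cdf N x"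
    using assms(1) by (simp add: weak_conv_m_def weak_conv_def)
  then show "(\<lambda>n. cdf (\<mu> (f n)) x) \<longlonglongrightarrow> cdf N x"
    using assms(2) by (rule filterlim_compose)
qed

lemma weak_conv_m_cong_eventually:
  assumes "weak_conv_m \<mu> N" "\<forall>\<^sub>F n in sequentially. \<mu> n = \<nu> n"
  shows "weak_conv_m \<nu> N"
  unfolding weak_conv_m_def weak_conv_def
proof (intro allI impI)
  fix x assume "isCont (cdf N) x"
  then have "(\<lambda>n. cdf (\<mu> n) x) \<longlonglongrightarrow> cdf N x"
    using assms(1) by (simp add: weak_conv_m_def weak_conv_def)
  then show "(\<lambda>n. cdf (\<nu> n) x) \<longlonglongrightarrow> cdf N x"
    by (rule Lim_transform_eventually) (use assms(2) in eventually_elim, simp)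
qed

section \<open>Second moments of bounded random variables\<close>

lemma (in prob_space) integrable_bounded:
  fixes f :: "'a \<Rightarrow> real"
  assumes "random_variable borel f" "\<And>\<omega>. \<bar>f \<omega>\<bar> \<le> B"
  shows "integrable M f"
  using assms by (intro integrable_const_bound[of _ B]) auto

lemma (in prob_space) integrable_square_bounded:
  fixes f :: "'a \<Rightarrow> real"
  assumes "random_variable borel f" "\<And>\<omega>. \<bar>f \<omega>\<bar> \<le> b"
  shows "integrable M (\<lambda>\<omega>. (f \<omega>)\<^sup>2)"
proof (rule integrable_bounded[of _ "b\<^sup>2"])
  have "0 \<le> b" using assms(2)[of undefined] by linarith
  then show "\<bar>(f \<omega>)\<^sup>2\<bar> \<le> b\<^sup>2" for \<omega>
    using assms(2)[of \<omega>] by (simp add: power2_le_iff_abs_le)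
qed (use assms in measurable)

lemma square_diff_le: "(x - y)\<^sup>2 \<le> 2 * x\<^sup>2 + 2 * y\<^sup>2" for x y :: real
  using zero_le_power2[of "x + y"] by (simp add: power2_sum power2_diff)

lemma square_add_le: "(x + y)\<^sup>2 \<le> 2 * x\<^sup>2 + 2 * y\<^sup>2" for x y :: real
  using square_diff_le[of x "- y"] by simp

lemma sqrt_minus_one_square_le:
  assumes "x \<ge> 0" shows "(sqrt x - 1)\<^sup>2 \<le> (x - 1)\<^sup>2"
proof -
  have "x - 1 = (sqrt x - 1) * (sqrt x + 1)"
    using assms by (simp add: algebra_simps flip: power2_eq_square)
  then have "(x - 1)\<^sup>2 = (sqrt x - 1)\<^sup>2 * (sqrt x + 1)\<^sup>2"
    by (simp add: power_mult_distrib)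
  moreover have "1\<^sup>2 \<le> (sqrt x + 1)\<^sup>2"
    using assms by (intro power_mono) auto
  ultimately show ?thesis
    using mult_left_mono[of 1 "(sqrt x + 1)\<^sup>2" "(sqrt x - 1)\<^sup>2"] by simp
qed

text \<open>If every summand is correlated with at most \<open>d\<close> others, at most \<open>d\<close> times the number of summands many terms of
  the expanded square count, instead of the square of that number.\<close>

lemma (in prob_space) second_moment_sum_le:
  fixes f :: "'i \<Rightarrow> 'a \<Rightarrow> real"
  assumes P: "finite P" and f: "\<And>p. p \<in> P \<Longrightarrow> random_variable borel (f p)"
    and B: "\<And>p \<omega>. \<bar>f p \<omega>\<bar> \<le> B"
    and orth: "\<And>p q. p \<in> P \<Longrightarrow> q \<in> P \<Longrightarrow> q \<notin> Q p \<Longrightarrow> expectation (\<lambda>\<omega>. f p \<omega> * f q \<omega>) = 0"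
    and Q: "\<And>p. p \<in> P \<Longrightarrow> finite (Q p)" "\<And>p. p \<in> P \<Longrightarrow> card (Q p) \<le> d"
  shows "expectation (\<lambda>\<omega>. (\<Sum>p\<in>P. f p \<omega>)\<^sup>2) \<le> real (card P) * (real d * B\<^sup>2)"
proof -
  have B0: "0 \<le> B" using B[of undefined undefined] by linarith
  have fB: "\<bar>f p \<omega> * f q \<omega>\<bar> \<le> B\<^sup>2" for p q \<omega>
    unfolding abs_mult power2_eq_square
    by (rule mult_mono[OF B B B0 abs_ge_zero])
  have int: "integrable M (\<lambda>\<omega>. f p \<omega> * f q \<omega>)" if "p \<in> P" "q \<in> P" for p q
    by (rule integrable_const_bound[of _ "B\<^sup>2"])
       (simp_all only: real_norm_def fB AE_I2 borel_measurable_times[OF f f] that)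
  have "expectation (\<lambda>\<omega>. (\<Sum>p\<in>P. f p \<omega>)\<^sup>2) = (\<Sum>p\<in>P. \<Sum>q\<in>P. expectation (\<lambda>\<omega>. f p \<omega> * f q \<omega>))"
    using int by (simp add: power2_eq_square sum_product)
  also have "\<dots> \<le> (\<Sum>p\<in>P. real d * B\<^sup>2)"
  proof (rule sum_mono)
    fix p assume p: "p \<in> P"
    have "(\<Sum>q\<in>P. expectation (\<lambda>\<omega>. f p \<omega> * f q \<omega>)) = (\<Sum>q\<in>P \<inter> Q p. expectation (\<lambda>\<omega>. f p \<omega> * f q \<omega>))"
      using P p orth by (intro sum.mono_neutral_right) auto
    also have "\<dots> \<le> (\<Sum>q\<in>P \<inter> Q p. B\<^sup>2)"
    proof (rule sum_mono)
      fix q assume q: "q \<in> P \<inter> Q p"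
      have "f p \<omega> * f q \<omega> \<le> B\<^sup>2" for \<omega>
        using fB[of p \<omega> q] by linarith
      then show "expectation (\<lambda>\<omega>. f p \<omega> * f q \<omega>) \<le> B\<^sup>2"
        using int[of p q] p q by (intro integral_le_const) auto
    qed
    also have "\<dots> = real (card (P \<inter> Q p)) * B\<^sup>2" by simp
    also have "\<dots> \<le> real d * B\<^sup>2"
    proof -
      have "card (P \<inter> Q p) \<le> card (Q p)" using Q(1)[OF p] by (intro card_mono) auto
      then show ?thesis using Q(2)[OF p] by (intro mult_right_mono) auto
    qed
    finally show "(\<Sum>q\<in>P. expectation (\<lambda>\<omega>. f p \<omega> * f q \<omega>)) \<le> real d * B\<^sup>2" .
  qed
  also have "\<dots> = real (card P) * (real d * B\<^sup>2)" by simp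
  finally show ?thesis .
qed

lemma (in prob_space) second_moment_sum_indep:
  fixes Y :: "nat \<Rightarrow> 'a \<Rightarrow> real"
  assumes ind: "indep_vars (\<lambda>_. borel) Y UNIV"
    and bd: "\<And>i \<omega>. \<bar>Y i \<omega>\<bar> \<le> b" and mean: "\<And>i. expectation (Y i) = 0"
    and sq: "\<And>i. expectation (\<lambda>\<omega>. (Y i \<omega>)\<^sup>2) = s"
  shows "expectation (\<lambda>\<omega>. (\<Sum>i<q. Y i \<omega>)\<^sup>2) = real q * s"
proof -
  have rv: "random_variable borel (Y i)" for i
    using ind by (auto simp: indep_vars_def)
  have b0: "0 \<le> b" using bd[of undefined undefined] by linarith
  have int: "integrable M (Y i)" for i
    by (rule integrable_const_bound[of _ b]) (simp_all add: bd rv)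
  have int2: "integrable M (\<lambda>\<omega>. Y i \<omega> * Y j \<omega>)" for i j
  proof (rule integrable_const_bound[of _ "b * b"])
    show "AE \<omega> in M. norm (Y i \<omega> * Y j \<omega>) \<le> b * b"
      unfolding real_norm_def abs_mult by (rule AE_I2, rule mult_mono[OF bd bd b0 abs_ge_zero])
  qed (intro borel_measurable_times rv)
  have E: "expectation (\<lambda>\<omega>. Y i \<omega> * Y j \<omega>) = (if i = j then s else 0)" for i j
  proof (cases "i = j")
    case False
    have "expectation (\<lambda>\<omega>. \<Prod>l\<in>{i, j}. Y l \<omega>) = (\<Prod>l\<in>{i, j}. expectation (Y l))"
      by (rule indep_vars_lebesgue_integral[OF _ indep_vars_subset[OF ind]]) (auto intro: int)
    then show ?thesis using False by (simp add: mean)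
  qed (simp add: sq flip: power2_eq_square)
  have "expectation (\<lambda>\<omega>. (\<Sum>i<q. Y i \<omega>)\<^sup>2) = (\<Sum>i<q. \<Sum>j<q. expectation (\<lambda>\<omega>. Y i \<omega> * Y j \<omega>))"
    using int2 by (simp add: power2_eq_square sum_product)
  also have "\<dots> = real q * s" by (simp add: E)
  finally show ?thesis .
qed

text \<open>With \<open>f = f' + r\<close> the mixed term \<open>2 \<bar>f' r\<bar>\<close> is at most \<open>\<eta> f'\<^sup>2 + r\<^sup>2 / \<eta>\<close>. A suitable
  \<open>\<eta>\<close> transfers the growth rate of a second moment to a nearby variable.\<close>

lemma (in prob_space) second_moment_perturb:
  fixes f f' :: "'a \<Rightarrow> real"
  assumes f: "integrable M (\<lambda>\<omega>. (f \<omega>)\<^sup>2)" "integrable M (\<lambda>\<omega>. (f' \<omega>)\<^sup>2)"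
    "integrable M (\<lambda>\<omega>. (f \<omega> - f' \<omega>)\<^sup>2)" and \<eta>: "\<eta> > 0"
  shows "\<bar>expectation (\<lambda>\<omega>. (f \<omega>)\<^sup>2) - expectation (\<lambda>\<omega>. (f' \<omega>)\<^sup>2)\<bar>
    \<le> \<eta> * expectation (\<lambda>\<omega>. (f' \<omega>)\<^sup>2) + (1 + 1 / \<eta>) * expectation (\<lambda>\<omega>. (f \<omega> - f' \<omega>)\<^sup>2)"
proof -
  have pt: "\<bar>x\<^sup>2 - y\<^sup>2\<bar> \<le> \<eta> * y\<^sup>2 + (1 + 1 / \<eta>) * (x - y)\<^sup>2" for x y :: real
  proof -
    have "0 \<le> (\<eta> * \<bar>y\<bar> - \<bar>x - y\<bar>)\<^sup>2 / \<eta>" using \<eta> by simp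
    also have "\<dots> = \<eta> * y\<^sup>2 + (x - y)\<^sup>2 / \<eta> - 2 * (\<bar>y\<bar> * \<bar>x - y\<bar>)"
      using \<eta> by (simp add: power2_diff power_mult_distrib field_simps) (simp add: power2_eq_square algebra_simps)
    finally have "2 * (\<bar>y\<bar> * \<bar>x - y\<bar>) \<le> \<eta> * y\<^sup>2 + (x - y)\<^sup>2 / \<eta>" by simp
    moreover have "\<bar>x\<^sup>2 - y\<^sup>2\<bar> \<le> 2 * (\<bar>y\<bar> * \<bar>x - y\<bar>) + (x - y)\<^sup>2"
    proof -
      have "x\<^sup>2 - y\<^sup>2 = 2 * (y * (x - y)) + (x - y)\<^sup>2" by (simp add: power2_eq_square algebra_simps)
      also have "\<bar>\<dots>\<bar> \<le> \<bar>2 * (y * (x - y))\<bar> + \<bar>(x - y)\<^sup>2\<bar>" by (rule abs_triangle_ineq)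
      finally show ?thesis by (simp add: abs_mult)
    qed
    ultimately show ?thesis by (simp add: distrib_right)
  qed
  have "\<bar>expectation (\<lambda>\<omega>. (f \<omega>)\<^sup>2) - expectation (\<lambda>\<omega>. (f' \<omega>)\<^sup>2)\<bar>
      = \<bar>expectation (\<lambda>\<omega>. (f \<omega>)\<^sup>2 - (f' \<omega>)\<^sup>2)\<bar>"
    using f by simp
  also have "\<dots> \<le> expectation (\<lambda>\<omega>. \<bar>(f \<omega>)\<^sup>2 - (f' \<omega>)\<^sup>2\<bar>)"
    by (rule integral_abs_bound)
  also have "\<dots> \<le> expectation (\<lambda>\<omega>. \<eta> * (f' \<omega>)\<^sup>2 + (1 + 1 / \<eta>) * (f \<omega> - f' \<omega>)\<^sup>2)"
    using f pt by (intro Bochner_Integration.integral_mono) auto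
  also have "\<dots> = \<eta> * expectation (\<lambda>\<omega>. (f' \<omega>)\<^sup>2) + (1 + 1 / \<eta>) * expectation (\<lambda>\<omega>. (f \<omega> - f' \<omega>)\<^sup>2)"
    using f by simp
  finally show ?thesis .
qed

section \<open>Independent and identically distributed processes\<close>

locale iid_process = prob_space M for M :: "'a measure" +
  fixes u :: "nat \<Rightarrow> 'a \<Rightarrow> real" and D :: "real measure"
  assumes indep: "indep_vars (\<lambda>_. borel) u {1..}"
    and ident: "\<And>t. t \<ge> 1 \<Longrightarrow> distr M borel (u t) = D"
begin

lemma random_variable_u [measurable]: "t \<ge> 1 \<Longrightarrow> random_variable borel (u t)"
  using indep by (auto simp: indep_vars_def)

lemma sets_D [measurable_cong, simp]: "sets D = sets borel"
  using ident[of 1] sets_distr by auto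

lemma space_D [simp]: "space D = UNIV"
  using sets_eq_imp_space_eq[OF sets_D] by simp

sublocale D: prob_space D
  using prob_space_distr[OF random_variable_u[of 1]] ident[of 1] by simp

sublocale PD: product_prob_space "\<lambda>_. D" UNIV
  by unfold_locales

lemma prob_space_PiM_D: "prob_space (PiM J (\<lambda>_. D))"
  by (rule prob_space_PiM) unfold_locales

lemma distr_reindexed:
  assumes "inj_on f J" "f \<in> J \<rightarrow> {1..}" "J \<noteq> {}"
  shows "distr M (PiM J (\<lambda>_. D)) (\<lambda>\<omega>. \<lambda>j\<in>J. u (f j) \<omega>) = PiM J (\<lambda>_. D)"
proof -
  have 1: "indep_vars (\<lambda>j. PiM {f j} (\<lambda>_. borel)) (\<lambda>j \<omega>. restrict (\<lambda>i. u i \<omega>) {f j}) J"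
    by (rule indep_vars_restrict[OF indep])
       (use assms in \<open>auto simp: disjoint_family_on_def inj_on_def\<close>)
  have "indep_vars (\<lambda>_. borel) (\<lambda>j \<omega>. (\<lambda>x. x (f j)) (restrict (\<lambda>i. u i \<omega>) {f j})) J"
    by (rule indep_vars_compose2[OF 1]) (rule measurable_component_singleton, simp)
  then have ind: "indep_vars (\<lambda>_. borel) (\<lambda>j. u (f j)) J"
    by simp
  have "distr M (PiM J (\<lambda>_. borel)) (\<lambda>\<omega>. \<lambda>j\<in>J. u (f j) \<omega>) = PiM J (\<lambda>j. distr M borel (u (f j)))"
    using ind assms by (subst indep_vars_iff_distr_eq_PiM'[symmetric]) (auto simp: Pi_iff)
  also have "\<dots> = PiM J (\<lambda>_. D)"
    using assms by (intro PiM_cong) (auto simp: Pi_iff ident)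
  also have "distr M (PiM J (\<lambda>_. borel)) (\<lambda>\<omega>. \<lambda>j\<in>J. u (f j) \<omega>)
      = distr M (PiM J (\<lambda>_. D)) (\<lambda>\<omega>. \<lambda>j\<in>J. u (f j) \<omega>)"
    by (intro distr_cong sets_PiM_cong) auto
  finally show ?thesis .
qed

lemma measurable_reindexed [measurable]:
  assumes "f \<in> J \<rightarrow> {1..}"
  shows "(\<lambda>\<omega>. \<lambda>j\<in>J. u (f j) \<omega>) \<in> M \<rightarrow>\<^sub>M PiM J (\<lambda>_. D)"
  using assms by (intro measurable_restrict) (auto simp: Pi_iff measurable_cong_sets[OF refl sets_D])

lemma expectation_reindexed:
  fixes g :: "('b \<Rightarrow> real) \<Rightarrow> real"
  assumes f: "inj_on f J" "f \<in> J \<rightarrow> {1..}" "J \<noteq> {}" and g: "g \<in> borel_measurable (PiM J (\<lambda>_. D))"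
  shows "expectation (\<lambda>\<omega>. g (\<lambda>j\<in>J. u (f j) \<omega>)) = (\<integral>y. g y \<partial>PiM J (\<lambda>_. D))"
proof -
  have "(\<integral>y. g y \<partial>PiM J (\<lambda>_. D)) = (\<integral>y. g y \<partial>distr M (PiM J (\<lambda>_. D)) (\<lambda>\<omega>. \<lambda>j\<in>J. u (f j) \<omega>))"
    by (simp add: distr_reindexed[OF f])
  also have "\<dots> = expectation (\<lambda>\<omega>. g (\<lambda>j\<in>J. u (f j) \<omega>))"
    using g f by (intro integral_distr) auto
  finally show ?thesis by simp
qed

lemma distr_reindexed_fun:
  fixes g :: "('b \<Rightarrow> real) \<Rightarrow> real"
  assumes f: "inj_on f J" "f \<in> J \<rightarrow> {1..}" "J \<noteq> {}" and g: "g \<in> borel_measurable (PiM J (\<lambda>_. D))"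
  shows "distr M borel (\<lambda>\<omega>. g (\<lambda>j\<in>J. u (f j) \<omega>)) = distr (PiM J (\<lambda>_. D)) borel g"
  using distr_distr[OF g measurable_reindexed[OF f(2)]]
  by (simp add: distr_reindexed[OF f] comp_def)

lemma expectation_prod:
  fixes g :: "nat \<Rightarrow> real \<Rightarrow> real"
  assumes I: "finite I" "I \<subseteq> {1..}"
    and g [measurable]: "\<And>i. i \<in> I \<Longrightarrow> g i \<in> borel_measurable borel"
    and bd: "\<And>i x. i \<in> I \<Longrightarrow> \<bar>g i x\<bar> \<le> B"
  shows "expectation (\<lambda>\<omega>. \<Prod>i\<in>I. g i (u i \<omega>)) = (\<Prod>i\<in>I. \<integral>x. g i x \<partial>D)"
proof -
  have ind: "indep_vars (\<lambda>_. borel) (\<lambda>i \<omega>. g i (u i \<omega>)) I"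
    using indep_vars_subset[OF indep I(2)] g by (rule indep_vars_compose2)
  have int: "integrable M (\<lambda>\<omega>. g i (u i \<omega>))" if "i \<in> I" for i
    using that I bd g[OF that] by (intro integrable_const_bound[of _ B]) (auto intro!: measurable_compose[OF random_variable_u])
  have "expectation (\<lambda>\<omega>. \<Prod>i\<in>I. g i (u i \<omega>)) = (\<Prod>i\<in>I. expectation (\<lambda>\<omega>. g i (u i \<omega>)))"
    using I(1) ind int by (rule indep_vars_lebesgue_integral)
  also have "\<dots> = (\<Prod>i\<in>I. \<integral>x. g i x \<partial>D)"
  proof (rule prod.cong)
    fix i assume i: "i \<in> I"
    then have i1: "i \<ge> 1" using I by auto
    have "(\<integral>x. g i x \<partial>distr M borel (u i)) = expectation (\<lambda>\<omega>. g i (u i \<omega>))"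
      using i i1 by (intro integral_distr) auto
    then show "expectation (\<lambda>\<omega>. g i (u i \<omega>)) = (\<integral>x. g i x \<partial>D)"
      using ident[OF i1] by simp
  qed simp
  finally show ?thesis .
qed

text \<open>Fubini's theorem for the coordinates in \<open>J\<close> against those in \<open>I\<close>: integrating out the former first
  already gives zero.\<close>

lemma expectation_block_zero:
  fixes \<Phi> :: "(nat \<Rightarrow> real) \<Rightarrow> real"
  assumes fin: "finite I" "finite J" and disj: "I \<inter> J = {}" and pos: "I \<union> J \<subseteq> {1..}" and ne: "I \<union> J \<noteq> {}"
    and \<Phi>: "\<Phi> \<in> borel_measurable (PiM (I \<union> J) (\<lambda>_. D))" and bd: "\<And>x. \<bar>\<Phi> x\<bar> \<le> B"
    and zero: "\<And>x. x \<in> space (PiM I (\<lambda>_. D)) \<Longrightarrow> (\<integral>y. \<Phi> (merge I J (x, y)) \<partial>PiM J (\<lambda>_. D)) = 0"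
  shows "expectation (\<lambda>\<omega>. \<Phi> (\<lambda>i\<in>I \<union> J. u i \<omega>)) = 0"
proof -
  interpret P: prob_space "PiM (I \<union> J) (\<lambda>_. D)" by (rule prob_space_PiM_D)
  have "expectation (\<lambda>\<omega>. \<Phi> (\<lambda>i\<in>I \<union> J. u i \<omega>)) = (\<integral>x. \<Phi> x \<partial>PiM (I \<union> J) (\<lambda>_. D))"
    using expectation_reindexed[of "\<lambda>i. i" "I \<union> J" \<Phi>] pos ne \<Phi> by auto
  also have "\<dots> = (\<integral>x. (\<integral>y. \<Phi> (merge I J (x, y)) \<partial>PiM J (\<lambda>_. D)) \<partial>PiM I (\<lambda>_. D))"
    using \<Phi> bd by (intro PD.product_integral_fold disj fin P.integrable_const_bound[of _ B]) auto
  also have "\<dots> = (\<integral>x. 0 \<partial>PiM I (\<lambda>_. D))"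
    by (rule Bochner_Integration.integral_cong) (simp_all add: zero)
  finally show ?thesis by simp
qed

text \<open>Functions of disjoint groups of observations are independent. The map \<open>f a\<close> lists the observation times of
  the \<open>a\<close>-th group, so that groups of the same shape can be fed into the same function.\<close>

lemma indep_blocks:
  fixes g :: "'i \<Rightarrow> ('b \<Rightarrow> real) \<Rightarrow> real"
  assumes f: "\<And>a. a \<in> A \<Longrightarrow> f a \<in> J a \<rightarrow> {1..}"
    and disj: "disjoint_family_on (\<lambda>a. f a ` J a) A"
    and g: "\<And>a. a \<in> A \<Longrightarrow> g a \<in> borel_measurable (PiM (J a) (\<lambda>_. D))"
  shows "indep_vars (\<lambda>_. borel) (\<lambda>a \<omega>. g a (\<lambda>j\<in>J a. u (f a j) \<omega>)) A"
proof -
  have 1: "indep_vars (\<lambda>a. PiM (f a ` J a) (\<lambda>_. borel)) (\<lambda>a \<omega>. restrict (\<lambda>i. u i \<omega>) (f a ` J a)) A"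
    by (rule indep_vars_restrict[OF indep _ disj]) (use f in fastforce)
  have 2: "indep_vars (\<lambda>_. borel) (\<lambda>a \<omega>. (\<lambda>x. g a (\<lambda>j\<in>J a. x (f a j))) (restrict (\<lambda>i. u i \<omega>) (f a ` J a))) A"
  proof (rule indep_vars_compose2[OF 1])
    fix a assume a: "a \<in> A"
    have "(\<lambda>x. \<lambda>j\<in>J a. x (f a j)) \<in> PiM (f a ` J a) (\<lambda>_. borel) \<rightarrow>\<^sub>M PiM (J a) (\<lambda>_. D)"
      by (intro measurable_restrict)
         (auto simp: measurable_cong_sets[OF refl sets_D])
    from measurable_compose[OF this g[OF a]]
    show "(\<lambda>x. g a (\<lambda>j\<in>J a. x (f a j))) \<in> borel_measurable (PiM (f a ` J a) (\<lambda>_. borel))" .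
  qed
  have "(\<lambda>j\<in>J a. restrict (\<lambda>i. u i \<omega>) (f a ` J a) (f a j)) = (\<lambda>j\<in>J a. u (f a j) \<omega>)" for a \<omega>
    by (auto simp: fun_eq_iff)
  with 2 show ?thesis by simp
qed

end

section \<open>Windows of a process and the projection of a kernel\<close>

text \<open>A kernel compares single observations; windows of length \<open>m\<close> are compared by the product of the
  kernel over their coordinates. For the correlation integral the kernel is the indicator of \<open>\<bar>x - y\<bar> < \<epsilon>\<close>.\<close>

locale kernel_process = iid_process +
  fixes k :: "real \<Rightarrow> real \<Rightarrow> real" and m :: nat
  assumes k_measurable: "case_prod k \<in> borel_measurable (borel \<Otimes>\<^sub>M borel)"
    and k_sym: "k x y = k y x"
    and k_nonneg: "0 \<le> k x y" and k_le_1: "k x y \<le> 1"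
    and m_pos: "m \<ge> 1"
begin

lemma measurable_k [measurable (raw)]:
  assumes "f \<in> borel_measurable N" "f' \<in> borel_measurable N"
  shows "(\<lambda>x. k (f x) (f' x)) \<in> borel_measurable N"
  using measurable_compose[OF measurable_Pair[OF assms] k_measurable] by simp

text \<open>\<open>F\<close> is the projection of the kernel on one argument; \<open>c\<close> and \<open>K\<close> are its first two moments.\<close>

definition "F x = (\<integral>y. k x y \<partial>D)"
definition "c = (\<integral>x. F x \<partial>D)"
definition "K = (\<integral>x. (F x)\<^sup>2 \<partial>D)"

lemma integrable_k: "integrable D (k x)"
  by (rule D.integrable_const_bound[of _ 1]) (auto simp: k_nonneg k_le_1)

lemma measurable_F [measurable]: "F \<in> borel_measurable borel"
  unfolding F_def by (rule D.borel_measurable_lebesgue_integral) measurable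

lemma F_nonneg: "0 \<le> F x"
  unfolding F_def by (rule Bochner_Integration.integral_nonneg) (rule k_nonneg)

lemma F_le_1: "F x \<le> 1"
  unfolding F_def using integrable_k by (rule D.integral_le_const) (simp add: k_le_1)

lemma integrable_F: "integrable D F"
  by (rule D.integrable_const_bound[of _ 1]) (auto simp: F_nonneg F_le_1)

lemma integrable_F2: "integrable D (\<lambda>x. (F x)\<^sup>2)"
  by (rule D.integrable_const_bound[of _ 1]) (auto simp: F_nonneg F_le_1 power_le_one)

lemma c_nonneg: "0 \<le> c"
  unfolding c_def by (rule Bochner_Integration.integral_nonneg) (rule F_nonneg)

lemma c_le_1: "c \<le> 1"
  unfolding c_def using integrable_F by (rule D.integral_le_const) (simp add: F_le_1)

lemma c_pow_bounds: "0 \<le> c ^ m" "c ^ m \<le> 1"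
  by (auto simp: c_nonneg c_le_1 power_le_one)

lemma c_square_le_K: "c\<^sup>2 \<le> K"
  using D.variance_positive[of F] integrable_F integrable_F2
  by (simp add: D.variance_eq c_def K_def)

abbreviation "window a \<equiv> {a..<a + m}"
abbreviation "traj \<omega> \<equiv> (\<lambda>i. u i \<omega>)"

text \<open>\<open>R\<close> and \<open>X\<close> are the degenerate and the linear part of the Hoeffding decomposition:
  \<open>h a b - c^m = R a b + X a + X b\<close>.\<close>

definition "h a b x = (\<Prod>j<m. k (x (a + j)) (x (b + j)))"
definition "g a x = (\<Prod>j<m. F (x (a + j)))"
definition "R a b x = h a b x - g a x - g b x + c ^ m"
definition "X a x = g a x - c ^ m"

lemma h_bounds: "0 \<le> h a b x" "h a b x \<le> 1"
  unfolding h_def by (auto intro!: prod_nonneg prod_le_1 simp: k_nonneg k_le_1)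

lemma g_bounds: "0 \<le> g a x" "g a x \<le> 1"
  unfolding g_def by (auto intro!: prod_nonneg prod_le_1 simp: F_nonneg F_le_1)

lemma X_bound: "\<bar>X a x\<bar> \<le> 1"
  using g_bounds[of a x] c_pow_bounds unfolding X_def by linarith

lemma R_bound: "\<bar>R a b x\<bar> \<le> 2"
  using g_bounds[of a x] g_bounds[of b x] h_bounds[of a b x] c_pow_bounds unfolding R_def by linarith

lemma h_sym: "h a b x = h b a x"
  unfolding h_def by (rule prod.cong[OF refl]) (rule k_sym)

lemma R_sym: "R a b x = R b a x"
  unfolding R_def by (simp add: h_sym[of a b])

lemma window_prod: "(\<Prod>j<m. f (a + j)) = (\<Prod>i\<in>window a. f i)" for f :: "nat \<Rightarrow> real"
  by (rule prod.reindex_bij_witness[of _ "\<lambda>i. i - a" "\<lambda>j. a + j"]) auto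

lemma h_cong: "(\<And>i. i \<in> window a \<union> window b \<Longrightarrow> x i = y i) \<Longrightarrow> h a b x = h a b y"
  unfolding h_def by (intro prod.cong refl arg_cong2[of _ _ _ _ k]) auto

lemma g_cong: "(\<And>i. i \<in> window a \<Longrightarrow> x i = y i) \<Longrightarrow> g a x = g a y"
  unfolding g_def by (intro prod.cong refl arg_cong[of _ _ F]) auto

lemma R_cong:
  assumes "\<And>i. i \<in> window a \<union> window b \<Longrightarrow> x i = y i" shows "R a b x = R a b y"
proof -
  have "h a b x = h a b y" "g a x = g a y" "g b x = g b y"
    using assms by (auto intro!: h_cong g_cong)
  then show ?thesis by (simp add: R_def)
qed

lemma measurable_h_PiM:
  assumes "window a \<union> window b \<subseteq> S"
  shows "h a b \<in> borel_measurable (PiM S (\<lambda>_. D))"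
proof -
  have [measurable]: "(\<lambda>x. x (a + j)) \<in> borel_measurable (PiM S (\<lambda>_. D))"
    "(\<lambda>x. x (b + j)) \<in> borel_measurable (PiM S (\<lambda>_. D))" if "j < m" for j
    using assms that by (auto simp flip: measurable_cong_sets[OF refl sets_D] intro!: measurable_component_singleton)
  show ?thesis unfolding h_def by (intro borel_measurable_prod) auto
qed

lemma measurable_g_PiM:
  assumes "window a \<subseteq> S"
  shows "g a \<in> borel_measurable (PiM S (\<lambda>_. D))"
proof -
  have [measurable]: "(\<lambda>x. x (a + j)) \<in> borel_measurable (PiM S (\<lambda>_. D))" if "j < m" for j
    using assms that by (auto simp flip: measurable_cong_sets[OF refl sets_D] intro!: measurable_component_singleton)
  show ?thesis unfolding g_def by (intro borel_measurable_prod) auto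
qed

lemma measurable_R_PiM:
  assumes "window a \<union> window b \<subseteq> S"
  shows "R a b \<in> borel_measurable (PiM S (\<lambda>_. D))"
  using measurable_h_PiM[OF assms] measurable_g_PiM[of a S] measurable_g_PiM[of b S] assms
  unfolding R_def by auto

lemma rv_h [measurable]: "a \<ge> 1 \<Longrightarrow> b \<ge> 1 \<Longrightarrow> random_variable borel (\<lambda>\<omega>. h a b (traj \<omega>))"
  unfolding h_def by measurable

lemma rv_g [measurable]: "a \<ge> 1 \<Longrightarrow> random_variable borel (\<lambda>\<omega>. g a (traj \<omega>))"
  unfolding g_def by measurable

lemma rv_R [measurable]: "a \<ge> 1 \<Longrightarrow> b \<ge> 1 \<Longrightarrow> random_variable borel (\<lambda>\<omega>. R a b (traj \<omega>))"
  unfolding R_def by measurable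

lemma rv_X [measurable]: "a \<ge> 1 \<Longrightarrow> random_variable borel (\<lambda>\<omega>. X a (traj \<omega>))"
  unfolding X_def by measurable

text \<open>Integrating out the observations in the window of \<open>a\<close> turns \<open>h a b\<close> into \<open>g b\<close> and \<open>g a\<close> into \<open>c^m\<close>, so
  the four terms of \<open>R a b\<close> cancel. The factor \<open>Z\<close> is a constant for this integration because it does not depend on
  that window.\<close>

lemma expectation_R_mult_eq_0:
  assumes ab: "a \<ge> 1" "b \<ge> 1" and S: "finite S" "S \<subseteq> {1..}" "window b \<subseteq> S" "S \<inter> window a = {}"
    and Z: "Z \<in> borel_measurable (PiM S (\<lambda>_. D))" and B: "\<And>x. \<bar>Z x\<bar> \<le> B"
  shows "expectation (\<lambda>\<omega>. R a b (traj \<omega>) * Z (\<lambda>i\<in>S. u i \<omega>)) = 0"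
proof -
  let ?J = "window a"
  let ?\<Phi> = "\<lambda>x. R a b x * Z (restrict x S)"
  interpret J: prob_space "PiM ?J (\<lambda>_. D)" by (rule prob_space_PiM_D)
  have "expectation (\<lambda>\<omega>. ?\<Phi> (\<lambda>i\<in>S \<union> ?J. u i \<omega>)) = 0"
  proof (rule expectation_block_zero)
    show "finite S" "finite ?J" "S \<inter> ?J = {}" "S \<union> ?J \<subseteq> {1..}" "S \<union> ?J \<noteq> {}"
      using S ab m_pos by auto
    have "(\<lambda>x. restrict x S) \<in> PiM (S \<union> ?J) (\<lambda>_. D) \<rightarrow>\<^sub>M PiM S (\<lambda>_. D)"
      by (rule measurable_restrict_subset) auto
    from measurable_compose[OF this Z]
    show "?\<Phi> \<in> borel_measurable (PiM (S \<union> ?J) (\<lambda>_. D))"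
      using S by (intro borel_measurable_times measurable_R_PiM) auto
    show "\<bar>?\<Phi> x\<bar> \<le> 2 * B" for x
      unfolding abs_mult using R_bound B by (intro mult_mono) auto
  next
    fix x assume "x \<in> space (PiM S (\<lambda>_. D))"
    let ?m = "\<lambda>y. merge S ?J (x, y)"
    have inJ: "?m y i = y i" if "i \<in> ?J" for y i
      using that S(4) by (auto simp: merge_def)
    have inb: "?m y i = x i" if "i \<in> window b" for y i
      using that S(3) by (auto simp: merge_def)
    have h: "h a b (?m y) = (\<Prod>i\<in>?J. k (x (b + (i - a))) (y i))" for y
    proof -
      have "h a b (?m y) = (\<Prod>j<m. k (x (b + (a + j - a))) (y (a + j)))"
        unfolding h_def using k_sym by (intro prod.cong) (auto simp: inJ inb)
      also have "\<dots> = (\<Prod>i\<in>?J. k (x (b + (i - a))) (y i))" by (rule window_prod)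
      finally show ?thesis .
    qed
    have ga: "g a (?m y) = (\<Prod>i\<in>?J. F (y i))" for y
      unfolding g_def window_prod[of "\<lambda>i. F (?m y i)"] by (intro prod.cong) (auto simp: inJ)
    have gb: "g b (?m y) = g b x" for y
      by (rule g_cong) (rule inb)
    have ih: "integrable (PiM ?J (\<lambda>_. D)) (\<lambda>y. \<Prod>i\<in>?J. k (x (b + (i - a))) (y i))"
      by (rule PD.product_integrable_prod) (auto intro: integrable_k)
    have ig: "integrable (PiM ?J (\<lambda>_. D)) (\<lambda>y. \<Prod>i\<in>?J. F (y i))"
      by (rule PD.product_integrable_prod) (auto intro: integrable_F)
    have eh: "(\<integral>y. (\<Prod>i\<in>?J. k (x (b + (i - a))) (y i)) \<partial>PiM ?J (\<lambda>_. D)) = g b x"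
    proof -
      have "(\<integral>y. (\<Prod>i\<in>?J. k (x (b + (i - a))) (y i)) \<partial>PiM ?J (\<lambda>_. D)) = (\<Prod>i\<in>?J. F (x (b + (i - a))))"
        unfolding F_def by (rule PD.product_integral_prod) (auto intro: integrable_k)
      also have "\<dots> = (\<Prod>j<m. F (x (b + (a + j - a))))"
        by (rule window_prod[symmetric])
      finally show ?thesis by (simp add: g_def)
    qed
    have eg: "(\<integral>y. (\<Prod>i\<in>?J. F (y i)) \<partial>PiM ?J (\<lambda>_. D)) = c ^ m"
      unfolding c_def by (subst PD.product_integral_prod) (auto intro: integrable_F)
    have "(\<integral>y. ?\<Phi> (?m y) \<partial>PiM ?J (\<lambda>_. D)) = (\<integral>y. R a b (?m y) * Z (restrict x S) \<partial>PiM ?J (\<lambda>_. D))"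
      using S(4) by (simp add: restrict_merge)
    also have "\<dots> = (\<integral>y. R a b (?m y) \<partial>PiM ?J (\<lambda>_. D)) * Z (restrict x S)"
      by simp
    also have "(\<integral>y. R a b (?m y) \<partial>PiM ?J (\<lambda>_. D)) = 0"
      unfolding R_def h ga gb using ih ig eh eg by (simp add: J.prob_space)
    also have "0 * Z (restrict x S) = 0" by simp
    finally show "(\<integral>y. ?\<Phi> (?m y) \<partial>PiM ?J (\<lambda>_. D)) = 0" .
  qed
  moreover have "?\<Phi> (\<lambda>i\<in>S \<union> ?J. u i \<omega>) = R a b (traj \<omega>) * Z (\<lambda>i\<in>S. u i \<omega>)" for \<omega>
  proof -
    have "R a b (\<lambda>i\<in>S \<union> ?J. u i \<omega>) = R a b (traj \<omega>)"
      using S by (intro R_cong) auto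
    moreover have "restrict (\<lambda>i\<in>S \<union> ?J. u i \<omega>) S = (\<lambda>i\<in>S. u i \<omega>)"
      by (auto simp: fun_eq_iff restrict_def)
    ultimately show ?thesis by simp
  qed
  ultimately show ?thesis by (simp only:)
qed

definition far :: "nat \<Rightarrow> nat \<Rightarrow> bool" where
  "far a b \<longleftrightarrow> a + m \<le> b \<or> b + m \<le> a"

lemma far_sym: "far a b \<longleftrightarrow> far b a"
  by (auto simp: far_def)

lemma far_windows: "far a b \<longleftrightarrow> window a \<inter> window b = {}"
  using m_pos by (auto simp: far_def)

lemma expectation_R_R_eq_0:
  assumes pos: "a \<ge> 1" "b \<ge> 1" "a' \<ge> 1" "b' \<ge> 1" and far: "far a b" "far a a'" "far a b'"
  shows "expectation (\<lambda>\<omega>. R a b (traj \<omega>) * R a' b' (traj \<omega>)) = 0"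
proof -
  let ?S = "window b \<union> window a' \<union> window b'"
  have "expectation (\<lambda>\<omega>. R a b (traj \<omega>) * R a' b' (\<lambda>i\<in>?S. u i \<omega>)) = 0"
    using pos far unfolding far_windows
    by (intro expectation_R_mult_eq_0[of _ _ _ _ 2] measurable_R_PiM R_bound) auto
  moreover have "R a' b' (\<lambda>i\<in>?S. u i \<omega>) = R a' b' (traj \<omega>)" for \<omega>
    by (intro R_cong) auto
  ultimately show ?thesis by simp
qed

lemma expectation_g: "a \<ge> 1 \<Longrightarrow> expectation (\<lambda>\<omega>. g a (traj \<omega>)) = c ^ m"
  unfolding g_def window_prod[of "\<lambda>i. F (u i _)"]
  by (subst expectation_prod[of _ "\<lambda>_. F" 1]) (auto simp: F_nonneg F_le_1 c_def)

lemma expectation_h_far: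
  assumes "a \<ge> 1" "b \<ge> 1" "far a b"
  shows "expectation (\<lambda>\<omega>. h a b (traj \<omega>)) = c ^ m"
proof -
  have "expectation (\<lambda>\<omega>. R a b (traj \<omega>) * (\<lambda>_. 1) (\<lambda>i\<in>window b. u i \<omega>)) = 0"
    using assms unfolding far_windows
    by (intro expectation_R_mult_eq_0[of a b "window b" "\<lambda>_. 1" 1]) auto
  then have "0 = expectation (\<lambda>\<omega>. R a b (traj \<omega>))" by simp
  also have "\<dots> = expectation (\<lambda>\<omega>. h a b (traj \<omega>)) - c ^ m - c ^ m + c ^ m"
  proof -
    have "integrable M (\<lambda>\<omega>. h a b (traj \<omega>))" "integrable M (\<lambda>\<omega>. g a (traj \<omega>))" "integrable M (\<lambda>\<omega>. g b (traj \<omega>))"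
      using assms h_bounds g_bounds by (auto intro!: integrable_bounded[of _ 1])
    then show ?thesis using assms by (simp add: R_def expectation_g prob_space)
  qed
  finally show ?thesis by simp
qed

definition "\<gamma> d = K ^ (m - d) * (c\<^sup>2) ^ min d m - (c\<^sup>2) ^ m"

text \<open>Two windows at distance \<open>d\<close> share \<open>m - d\<close> observations, each of which contributes \<open>E F\<^sup>2 = K\<close>, and there are
  \<open>2 * min d m\<close> observations in exactly one of them, each of which contributes \<open>c\<close>.\<close>

lemma expectation_g_g:
  assumes a: "a \<ge> 1"
  shows "expectation (\<lambda>\<omega>. g a (traj \<omega>) * g (a + d) (traj \<omega>)) = K ^ (m - d) * (c\<^sup>2) ^ min d m"
proof -
  let ?A = "window a" and ?B = "window (a + d)"
  let ?I = "?A \<union> ?B"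
  \<comment> \<open>the factor of the coordinate \<open>i\<close>; it is \<open>(F x)\<^sup>2\<close> on the common part of the windows\<close>
  define f where "f i x = (if i \<in> ?A then F x else 1) * (if i \<in> ?B then F x else 1)" for i x
  have gA: "g a (traj \<omega>) = (\<Prod>i\<in>?I. if i \<in> ?A then F (u i \<omega>) else 1)" for \<omega>
    unfolding g_def window_prod[of "\<lambda>i. F (u i \<omega>)"]
    by (rule prod.mono_neutral_cong_left) auto
  have gB: "g (a + d) (traj \<omega>) = (\<Prod>i\<in>?I. if i \<in> ?B then F (u i \<omega>) else 1)" for \<omega>
    unfolding g_def window_prod[of "\<lambda>i. F (u i \<omega>)"]
    by (rule prod.mono_neutral_cong_left) auto
  have "expectation (\<lambda>\<omega>. g a (traj \<omega>) * g (a + d) (traj \<omega>)) = expectation (\<lambda>\<omega>. \<Prod>i\<in>?I. f i (u i \<omega>))"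
    by (simp only: gA gB f_def prod.distrib)
  also have "\<dots> = (\<Prod>i\<in>?I. \<integral>x. f i x \<partial>D)"
  proof (rule expectation_prod[of _ _ 1])
    show "?I \<subseteq> {1..}" using a by auto
    show "f i \<in> borel_measurable borel" for i unfolding f_def by measurable
    show "\<bar>f i x\<bar> \<le> 1" for i x
      unfolding f_def using F_nonneg[of x] F_le_1[of x] by (auto simp: abs_mult mult_le_one)
  qed simp
  also have "\<dots> = (\<Prod>i\<in>?I. if i \<in> ?A \<inter> ?B then K else c)"
    by (intro prod.cong refl) (auto simp: f_def K_def c_def power2_eq_square)
  also have "\<dots> = K ^ card (?A \<inter> ?B) * c ^ card (?I - ?A \<inter> ?B)"
  proof -
    have "?I \<inter> {i. i \<in> ?A \<inter> ?B} = ?A \<inter> ?B" "?I \<inter> - {i. i \<in> ?A \<inter> ?B} = ?I - ?A \<inter> ?B" by auto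
    then show ?thesis by (subst prod.If_cases) simp_all
  qed
  also have "?A \<inter> ?B = {a + d..<a + m}" by auto
  also have "?I - {a + d..<a + m} = (if d \<le> m then {a..<a + d} \<union> {a + m..<a + d + m} else ?A \<union> ?B)"
    by auto
  also have "card \<dots> = 2 * min d m"
  proof (cases "d \<le> m")
    case True
    then show ?thesis by simp (subst card_Un_disjoint; auto)
  next
    case False
    then show ?thesis by simp (subst card_Un_disjoint; auto)
  qed
  finally show ?thesis by (simp add: power_mult)
qed

lemma expectation_X_X:
  assumes a: "a \<ge> 1"
  shows "expectation (\<lambda>\<omega>. X a (traj \<omega>) * X (a + d) (traj \<omega>)) = \<gamma> d"
proof -
  have int: "integrable M (\<lambda>\<omega>. g a (traj \<omega>))" "integrable M (\<lambda>\<omega>. g (a + d) (traj \<omega>))"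
    "integrable M (\<lambda>\<omega>. g a (traj \<omega>) * g (a + d) (traj \<omega>))"
    using a g_bounds by (auto intro!: integrable_bounded[of _ 1] simp: abs_mult mult_le_one)
  have "expectation (\<lambda>\<omega>. X a (traj \<omega>) * X (a + d) (traj \<omega>))
      = expectation (\<lambda>\<omega>. g a (traj \<omega>) * g (a + d) (traj \<omega>) - c ^ m * g a (traj \<omega>)
          - c ^ m * g (a + d) (traj \<omega>) + c ^ m * c ^ m)"
    by (simp add: X_def algebra_simps)
  also have "\<dots> = \<gamma> d"
    using a int by (simp add: expectation_g expectation_g_g prob_space \<gamma>_def power_mult_distrib
        power2_eq_square)
  finally show ?thesis .
qed

lemma \<gamma>_nonneg: "\<gamma> d \<ge> 0"
proof -
  have "(c\<^sup>2) ^ m = (c\<^sup>2) ^ (m - d) * (c\<^sup>2) ^ min d m"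
    by (simp add: min_def flip: power_add)
  also have "\<dots> \<le> K ^ (m - d) * (c\<^sup>2) ^ min d m"
    by (intro mult_right_mono power_mono c_square_le_K) auto
  finally show ?thesis by (simp add: \<gamma>_def)
qed

lemma \<gamma>_eq_0: "d \<ge> m \<Longrightarrow> \<gamma> d = 0"
  by (simp add: \<gamma>_def min_def)

text \<open>\<open>K - c\<^sup>2\<close> is the variance of \<open>F\<close>.\<close>

lemma \<gamma>_0_pos: "c\<^sup>2 \<noteq> K \<Longrightarrow> \<gamma> 0 > 0"
  using c_square_le_K m_pos by (simp add: \<gamma>_def power_strict_mono)

lemma expectation_X_X_far:
  assumes "a \<ge> 1" "b \<ge> 1" "far a b"
  shows "expectation (\<lambda>\<omega>. X a (traj \<omega>) * X b (traj \<omega>)) = 0"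
proof -
  have *: "expectation (\<lambda>\<omega>. X a (traj \<omega>) * X b (traj \<omega>)) = 0" if "a \<ge> 1" "a + m \<le> b" for a b
    using expectation_X_X[of a "b - a"] that by (simp add: \<gamma>_eq_0)
  show ?thesis
    using assms *[of a b] *[of b a] by (auto simp: far_def mult.commute)
qed

end

section \<open>The degenerate part of the sum over distant pairs\<close>

context kernel_process
begin

definition "near a = {s. \<not> far a s}"

lemma near_subset: "near a \<subseteq> {a + 1 - m..<a + m}"
  by (auto simp: near_def far_def)

lemma finite_near: "finite (near a)"
  using near_subset by (rule finite_subset) simp

lemma card_near: "card (near a) \<le> 2 * m"
proof -
  have "card (near a) \<le> card {a + 1 - m..<a + m}" by (rule card_mono[OF _ near_subset]) simp
  also have "\<dots> \<le> 2 * m" by auto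
  finally show ?thesis .
qed

lemma second_moment_sum_X_le:
  assumes "finite G" "G \<subseteq> {1..}"
  shows "expectation (\<lambda>\<omega>. (\<Sum>t\<in>G. X t (traj \<omega>))\<^sup>2) \<le> real (card G) * real (2 * m)"
proof -
  have "expectation (\<lambda>\<omega>. (\<Sum>t\<in>G. X t (traj \<omega>))\<^sup>2) \<le> real (card G) * (real (2 * m) * 1\<^sup>2)"
    using assms
    by (intro second_moment_sum_le[where Q = near] X_bound expectation_X_X_far finite_near card_near)
       (auto simp: near_def)
  then show ?thesis by simp
qed

definition "far_pairs n = {(a, b). a \<in> {1..n} \<and> b \<in> {1..n} \<and> far a b}"

lemma finite_far_pairs: "finite (far_pairs n)"
  by (rule finite_subset[of _ "{1..n} \<times> {1..n}"]) (auto simp: far_pairs_def)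

lemma card_far_pairs: "card (far_pairs n) \<le> n * n"
proof -
  have "card (far_pairs n) \<le> card ({1..n} \<times> {1..n})"
    by (rule card_mono) (auto simp: far_pairs_def)
  then show ?thesis by simp
qed

text \<open>If \<open>a'\<close> is far from both \<open>a\<close> and \<open>b\<close>, then \<open>R a' b'\<close> is orthogonal to \<open>R a b\<close>, and by symmetry the same
  holds for \<open>b'\<close>. So a pair interacts only with pairs both of whose members are near to one of its own.\<close>

lemma second_moment_sum_R_le:
  "expectation (\<lambda>\<omega>. (\<Sum>(a, b)\<in>far_pairs n. R a b (traj \<omega>))\<^sup>2) \<le> (8 * real m * real n)\<^sup>2"
proof -
  define Q where "Q = (\<lambda>(a, b). (near a \<union> near b) \<times> (near a \<union> near b))"
  have "expectation (\<lambda>\<omega>. (\<Sum>p\<in>far_pairs n. (case p of (a, b) \<Rightarrow> R a b (traj \<omega>)))\<^sup>2)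
      \<le> real (card (far_pairs n)) * (real ((4 * m) * (4 * m)) * 2\<^sup>2)"
  proof (rule second_moment_sum_le[where Q = Q])
    show "finite (far_pairs n)" by (rule finite_far_pairs)
    show "random_variable borel (\<lambda>\<omega>. case p of (a, b) \<Rightarrow> R a b (traj \<omega>))" if "p \<in> far_pairs n" for p
      using that by (auto simp: far_pairs_def)
    show "\<bar>case p of (a, b) \<Rightarrow> R a b (traj \<omega>)\<bar> \<le> 2" for p \<omega>
      by (auto split: prod.split intro: R_bound)
    show "finite (Q p)" for p by (auto simp: Q_def finite_near split: prod.split)
    show "card (Q p) \<le> (4 * m) * (4 * m)" for p
    proof (cases p)
      case (Pair a b)
      have "card (near a \<union> near b) \<le> 4 * m"
        using card_Un_le[of "near a" "near b"] card_near[of a] card_near[of b] by linarith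
      then show ?thesis unfolding Pair Q_def prod.case card_cartesian_product by (intro mult_le_mono)
    qed
    show "expectation (\<lambda>\<omega>. (case p of (a, b) \<Rightarrow> R a b (traj \<omega>)) * (case q of (a, b) \<Rightarrow> R a b (traj \<omega>))) = 0"
      if pq: "p \<in> far_pairs n" "q \<in> far_pairs n" "q \<notin> Q p" for p q
    proof -
      obtain a b a' b' where [simp]: "p = (a, b)" "q = (a', b')" by (cases p, cases q)
      have *: "a \<ge> 1" "b \<ge> 1" "a' \<ge> 1" "b' \<ge> 1" "far a b" "far a' b'"
        using pq by (auto simp: far_pairs_def)
      have "(far a' a \<and> far a' b) \<or> (far b' a \<and> far b' b)"
        using pq(3) by (auto simp: Q_def near_def far_sym)
      then have "expectation (\<lambda>\<omega>. R a' b' (traj \<omega>) * R a b (traj \<omega>)) = 0"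
      proof
        assume "far a' a \<and> far a' b"
        then show ?thesis using * by (intro expectation_R_R_eq_0) auto
      next
        assume "far b' a \<and> far b' b"
        then show ?thesis using * far_sym[of a' b'] unfolding R_sym[of a' b']
          by (intro expectation_R_R_eq_0) auto
      qed
      then show ?thesis by (simp add: mult.commute)
    qed
  qed
  also have "\<dots> \<le> real (n * n) * (real ((4 * m) * (4 * m)) * 2\<^sup>2)"
    using card_far_pairs[of n] by (intro mult_right_mono) (auto simp flip: of_nat_mult)
  also have "\<dots> = (8 * real m * real n)\<^sup>2"
    by (simp add: power2_eq_square)
  finally show ?thesis .
qed

definition "S n x = (\<Sum>t=1..n. X t x)"

lemma rv_S [measurable]: "random_variable borel (\<lambda>\<omega>. S n (traj \<omega>))"
  unfolding S_def by (intro borel_measurable_sum rv_X) auto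

lemma S_bound: "\<bar>S n x\<bar> \<le> real n"
proof -
  have "\<bar>S n x\<bar> \<le> (\<Sum>t=1..n. \<bar>X t x\<bar>)" unfolding S_def by (rule sum_abs)
  also have "\<dots> \<le> (\<Sum>t=1..n. 1)" by (intro sum_mono X_bound)
  finally show ?thesis by simp
qed

definition "far_sum n x = (\<Sum>(a, b)\<in>far_pairs n. h a b x - c ^ m)"

lemma sum_far_pairs_swap: "(\<Sum>(a, b)\<in>far_pairs n. f b a) = (\<Sum>(a, b)\<in>far_pairs n. f a b)"
  for f :: "nat \<Rightarrow> nat \<Rightarrow> real"
  by (rule sum.reindex_bij_witness[of _ prod.swap prod.swap]) (auto simp: far_pairs_def far_sym)

text \<open>Summing the Hoeffding decomposition over all distant ordered pairs counts each \<open>X a\<close> twice for every \<open>b\<close> that is far from \<open>a\<close>,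
  that is \<open>2 n\<close> times except for the boundedly many near \<open>b\<close>.\<close>

lemma far_sum_decomp:
  "far_sum n x - 2 * real n * S n x
    = (\<Sum>(a, b)\<in>far_pairs n. R a b x) - 2 * (\<Sum>a=1..n. \<Sum>b\<in>{1..n} \<inter> near a. X a x)"
proof -
  have 1: "far_sum n x = (\<Sum>(a, b)\<in>far_pairs n. R a b x)
      + (\<Sum>(a, b)\<in>far_pairs n. X a x) + (\<Sum>(a, b)\<in>far_pairs n. X b x)"
    unfolding far_sum_def sum.distrib[symmetric]
    by (rule sum.cong) (auto simp: R_def X_def)
  have 2: "(\<Sum>(a, b)\<in>far_pairs n. X b x) = (\<Sum>(a, b)\<in>far_pairs n. X a x)"
    by (rule sum_far_pairs_swap)
  have "far_pairs n = (SIGMA a:{1..n}. {1..n} - near a)"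
    by (auto simp: far_pairs_def near_def)
  then have "(\<Sum>(a, b)\<in>far_pairs n. X a x) = (\<Sum>a=1..n. \<Sum>b\<in>{1..n} - near a. X a x)"
    by (subst sum.Sigma) simp_all
  also have "\<dots> = (\<Sum>a=1..n. (\<Sum>b=1..n. X a x) - (\<Sum>b\<in>{1..n} \<inter> near a. X a x))"
  proof (rule sum.cong[OF refl])
    fix a
    show "(\<Sum>b\<in>{1..n} - near a. X a x) = (\<Sum>b=1..n. X a x) - (\<Sum>b\<in>{1..n} \<inter> near a. X a x)"
      by (subst sum.Int_Diff[of "{1..n}" _ "near a"]) (simp_all add: algebra_simps)
  qed
  also have "\<dots> = real n * S n x - (\<Sum>a=1..n. \<Sum>b\<in>{1..n} \<inter> near a. X a x)"
    by (simp add: sum_subtractf S_def sum_distrib_left)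
  finally show ?thesis using 1 2 by simp
qed

lemma near_sum_bound: "\<bar>\<Sum>a=1..n. \<Sum>b\<in>{1..n} \<inter> near a. X a x\<bar> \<le> 2 * real m * real n"
proof -
  have "\<bar>\<Sum>a=1..n. \<Sum>b\<in>{1..n} \<inter> near a. X a x\<bar> \<le> (\<Sum>a=1..n. \<bar>\<Sum>b\<in>{1..n} \<inter> near a. X a x\<bar>)"
    by (rule sum_abs)
  also have "\<dots> \<le> (\<Sum>a=1..n. 2 * real m)"
  proof (rule sum_mono)
    fix a
    have "\<bar>\<Sum>b\<in>{1..n} \<inter> near a. X a x\<bar> = real (card ({1..n} \<inter> near a)) * \<bar>X a x\<bar>"
      by (simp add: abs_mult)
    also have "\<dots> \<le> real (2 * m) * 1"
    proof (intro mult_mono X_bound)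
      have "card ({1..n} \<inter> near a) \<le> card (near a)" by (intro card_mono finite_near) auto
      then show "real (card ({1..n} \<inter> near a)) \<le> real (2 * m)" using card_near[of a] by linarith
    qed auto
    finally show "\<bar>\<Sum>b\<in>{1..n} \<inter> near a. X a x\<bar> \<le> 2 * real m" by simp
  qed
  finally show ?thesis by (simp add: mult.commute)
qed

lemma rv_far_sum [measurable]: "random_variable borel (\<lambda>\<omega>. far_sum n (traj \<omega>))"
  unfolding far_sum_def by (intro borel_measurable_sum) (auto simp: far_pairs_def)

lemma h_diff_bound: "\<bar>h a b x - c ^ m\<bar> \<le> 1"
  using h_bounds[of a b x] c_pow_bounds by linarith

lemma far_sum_bound: "\<bar>far_sum n x\<bar> \<le> real (n * n)"
proof -
  have "\<bar>far_sum n x\<bar> \<le> (\<Sum>p\<in>far_pairs n. \<bar>case p of (a, b) \<Rightarrow> h a b x - c ^ m\<bar>)"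
    unfolding far_sum_def by (rule sum_abs)
  also have "\<dots> \<le> (\<Sum>p\<in>far_pairs n. 1)" by (rule sum_mono) (auto intro: h_diff_bound split: prod.split)
  also have "\<dots> \<le> real (n * n)" using card_far_pairs[of n] by (simp flip: of_nat_mult)
  finally show ?thesis .
qed

lemma expectation_far_sum: "expectation (\<lambda>\<omega>. far_sum n (traj \<omega>)) = 0"
proof -
  have int: "integrable M (\<lambda>\<omega>. case p of (a, b) \<Rightarrow> h a b (traj \<omega>) - c ^ m)" if "p \<in> far_pairs n" for p
    using that h_diff_bound by (auto simp: far_pairs_def intro!: integrable_bounded[of _ 1])
  have "expectation (\<lambda>\<omega>. far_sum n (traj \<omega>))
      = (\<Sum>p\<in>far_pairs n. expectation (\<lambda>\<omega>. case p of (a, b) \<Rightarrow> h a b (traj \<omega>) - c ^ m))"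
    unfolding far_sum_def using int by (rule Bochner_Integration.integral_sum)
  also have "\<dots> = 0"
  proof (rule sum.neutral, rule ballI)
    fix p assume p: "p \<in> far_pairs n"
    obtain a b where [simp]: "p = (a, b)" by (cases p)
    have "integrable M (\<lambda>\<omega>. h a b (traj \<omega>))"
      using p h_bounds by (auto simp: far_pairs_def intro!: integrable_bounded[of _ 1])
    then show "expectation (\<lambda>\<omega>. case p of (a, b) \<Rightarrow> h a b (traj \<omega>) - c ^ m) = 0"
      using p by (simp add: far_pairs_def expectation_h_far prob_space)
  qed
  finally show ?thesis .
qed

text \<open>When \<open>K \<noteq> c\<^sup>2\<close>, the main term \<open>2 n S n\<close> has standard deviation of order \<open>n\<close> to the power \<open>3/2\<close>, against
  which an error of order \<open>n\<close> is negligible.\<close>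

lemma far_sum_projection:
  "expectation (\<lambda>\<omega>. (far_sum n (traj \<omega>) - 2 * real n * S n (traj \<omega>))\<^sup>2) \<le> 160 * (real m * real n)\<^sup>2"
proof -
  let ?R = "\<lambda>\<omega>. \<Sum>(a, b)\<in>far_pairs n. R a b (traj \<omega>)"
  have [measurable]: "random_variable borel ?R"
    by (intro borel_measurable_sum) (auto simp: far_pairs_def)
  have Rb: "\<bar>?R \<omega>\<bar> \<le> real (card (far_pairs n)) * 2" for \<omega>
  proof -
    have "\<bar>?R \<omega>\<bar> \<le> (\<Sum>p\<in>far_pairs n. \<bar>case p of (a, b) \<Rightarrow> R a b (traj \<omega>)\<bar>)" by (rule sum_abs)
    also have "\<dots> \<le> (\<Sum>p\<in>far_pairs n. 2)" by (rule sum_mono) (auto intro: R_bound split: prod.split)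
    finally show ?thesis by simp
  qed
  have "(?R \<omega>)\<^sup>2 \<le> (real (card (far_pairs n)) * 2)\<^sup>2" for \<omega>
    using Rb[of \<omega>] by (intro power2_le_iff_abs_le[THEN iffD2]) auto
  then have int: "integrable M (\<lambda>\<omega>. (?R \<omega>)\<^sup>2)"
    by (intro integrable_bounded[of _ "(real (card (far_pairs n)) * 2)\<^sup>2"]) simp_all
  have "expectation (\<lambda>\<omega>. (far_sum n (traj \<omega>) - 2 * real n * S n (traj \<omega>))\<^sup>2)
      \<le> expectation (\<lambda>\<omega>. 2 * (?R \<omega>)\<^sup>2 + 2 * (4 * real m * real n)\<^sup>2)"
  proof (rule integral_mono')
    fix \<omega>
    let ?Y = "2 * (\<Sum>a=1..n. \<Sum>b\<in>{1..n} \<inter> near a. X a (traj \<omega>))"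
    have "?Y\<^sup>2 \<le> (4 * real m * real n)\<^sup>2"
      using near_sum_bound[of "traj \<omega>" n] by (intro power2_le_iff_abs_le[THEN iffD2]) auto
    moreover have "(?R \<omega> - ?Y)\<^sup>2 \<le> 2 * (?R \<omega>)\<^sup>2 + 2 * ?Y\<^sup>2"
      by (rule square_diff_le)
    ultimately show "(far_sum n (traj \<omega>) - 2 * real n * S n (traj \<omega>))\<^sup>2 \<le> 2 * (?R \<omega>)\<^sup>2 + 2 * (4 * real m * real n)\<^sup>2"
      unfolding far_sum_decomp by linarith
  qed (use int in auto)
  also have "\<dots> = 2 * expectation (\<lambda>\<omega>. (?R \<omega>)\<^sup>2) + 2 * (4 * real m * real n)\<^sup>2"
    using int by (simp add: prob_space)
  also have "\<dots> \<le> 2 * (8 * real m * real n)\<^sup>2 + 2 * (4 * real m * real n)\<^sup>2"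
    using second_moment_sum_R_le[of n] by simp
  also have "\<dots> = 160 * (real m * real n)\<^sup>2" by (simp add: power2_eq_square)
  finally show ?thesis .
qed

end

section \<open>Central limit theorem for the projection\<close>

lemma tendsto_div_over_self:
  fixes p :: nat assumes "p \<ge> 1"
  shows "(\<lambda>n. real (n div p) / real n) \<longlonglongrightarrow> 1 / real p"
proof (rule LIM_zero_cancel, rule Lim_null_comparison)
  show "(\<lambda>n. 1 / real n) \<longlonglongrightarrow> 0" by (rule lim_1_over_n)
  show "\<forall>\<^sub>F n in sequentially. norm (real (n div p) / real n - 1 / real p) \<le> 1 / real n"
    using eventually_gt_at_top[of 0]
  proof eventually_elim
    case (elim n)
    have "real n = real p * real (n div p) + real (n mod p)"
      by (simp flip: of_nat_mult of_nat_add)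
    then have "real (n div p) / real n - 1 / real p = - (real (n mod p) / real p) / real n"
      using elim assms by (simp add: field_simps)
    moreover have "real (n mod p) / real p \<le> 1"
      using assms by (simp add: less_imp_le)
    ultimately show ?case
      using elim divide_right_mono[of "real (n mod p) / real p" 1 "real n"] by simp
  qed
qed

lemma div_block_index:
  fixes x :: nat
  assumes "j * p + 1 \<le> x" "x \<le> j * p + p"
  shows "(x - 1) div p = j"
proof (rule div_nat_eqI)
  have "p * j = j * p" by simp
  then show "p * j \<le> x - 1" "x - 1 < p * Suc j"
    using assms unfolding mult_Suc_right by linarith+
qed

lemma filterlim_div_at_top:
  fixes p :: nat assumes "p \<ge> 1" shows "filterlim (\<lambda>n. n div p) at_top sequentially"
  unfolding filterlim_at_top
proof
  fix Z show "\<forall>\<^sub>F n in sequentially. Z \<le> n div p"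
    using eventually_ge_at_top[of "Z * p"]
    by eventually_elim (use assms in \<open>simp add: less_eq_div_iff_mult_less_eq\<close>)
qed

context kernel_process
begin

text \<open>The long-run variance of the stationary sequence \<open>X\<close>.\<close>

definition "v = \<gamma> 0 + 2 * (\<Sum>d\<in>{1..<m}. \<gamma> d)"

definition "var_S n = expectation (\<lambda>\<omega>. (S n (traj \<omega>))\<^sup>2)"

lemma integrable_S_square: "integrable M (\<lambda>\<omega>. (S n (traj \<omega>))\<^sup>2)"
  by (rule integrable_square_bounded[OF rv_S S_bound])

lemma v_pos: "c\<^sup>2 \<noteq> K \<Longrightarrow> v > 0"
  unfolding v_def using \<gamma>_0_pos \<gamma>_nonneg by (intro add_pos_nonneg mult_nonneg_nonneg sum_nonneg) auto

lemma var_S_0 [simp]: "var_S 0 = 0"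
  by (simp add: var_S_def S_def)

lemma var_S_Suc: "var_S (Suc n) = var_S n + (\<gamma> 0 + 2 * (\<Sum>d=1..n. \<gamma> d))"
proof -
  have int: "integrable M (\<lambda>\<omega>. X s (traj \<omega>) * X t (traj \<omega>))" if "s \<ge> 1" "t \<ge> 1" for s t
  proof (rule integrable_bounded[of _ 1])
    show "\<bar>X s (traj \<omega>) * X t (traj \<omega>)\<bar> \<le> 1" for \<omega>
      unfolding abs_mult by (intro mult_le_one X_bound abs_ge_zero)
  qed (use that in measurable)
  have "(S (Suc n) (traj \<omega>))\<^sup>2 = (S n (traj \<omega>))\<^sup>2
      + 2 * (\<Sum>t=1..n. X t (traj \<omega>) * X (Suc n) (traj \<omega>)) + X (Suc n) (traj \<omega>) * X (Suc n) (traj \<omega>)" for \<omega>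
    by (simp add: S_def power2_eq_square algebra_simps sum_distrib_left)
  moreover have intsum: "integrable M (\<lambda>\<omega>. \<Sum>t=1..n. X t (traj \<omega>) * X (Suc n) (traj \<omega>))"
    by (intro Bochner_Integration.integrable_sum int) auto
  moreover have "expectation (\<lambda>\<omega>. \<Sum>t=1..n. X t (traj \<omega>) * X (Suc n) (traj \<omega>))
      = (\<Sum>t=1..n. expectation (\<lambda>\<omega>. X t (traj \<omega>) * X (Suc n) (traj \<omega>)))"
    by (intro Bochner_Integration.integral_sum int) auto
  ultimately have "var_S (Suc n) = var_S n + 2 * (\<Sum>t=1..n. expectation (\<lambda>\<omega>. X t (traj \<omega>) * X (Suc n) (traj \<omega>)))
      + expectation (\<lambda>\<omega>. X (Suc n) (traj \<omega>) * X (Suc n) (traj \<omega>))"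
    using int[of "Suc n" "Suc n"] integrable_S_square[of n] by (simp add: var_S_def)
  also have "expectation (\<lambda>\<omega>. X (Suc n) (traj \<omega>) * X (Suc n) (traj \<omega>)) = \<gamma> 0"
    using expectation_X_X[of "Suc n" 0] by simp
  also have "(\<Sum>t=1..n. expectation (\<lambda>\<omega>. X t (traj \<omega>) * X (Suc n) (traj \<omega>))) = (\<Sum>t=1..n. \<gamma> (Suc n - t))"
  proof (rule sum.cong[OF refl])
    fix t assume "t \<in> {1..n}"
    then show "expectation (\<lambda>\<omega>. X t (traj \<omega>) * X (Suc n) (traj \<omega>)) = \<gamma> (Suc n - t)"
      using expectation_X_X[of t "Suc n - t"] by simp
  qed
  also have "\<dots> = (\<Sum>d=1..n. \<gamma> d)"
    by (rule sum.reindex_bij_witness[of _ "\<lambda>d. Suc n - d" "\<lambda>d. Suc n - d"]) auto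
  finally show ?thesis by simp
qed

lemma var_S_pos: assumes "c\<^sup>2 \<noteq> K" "n \<ge> 1" shows "var_S n > 0"
  using assms(2)
proof (induction n rule: dec_induct)
  case base
  show ?case using var_S_Suc[of 0] \<gamma>_0_pos[OF assms(1)] by simp
next
  case (step n)
  then show ?case
    using \<gamma>_0_pos[OF assms(1)] sum_nonneg[of "{1..n}" \<gamma>] \<gamma>_nonneg by (simp add: var_S_Suc)
qed

text \<open>From \<open>n = m\<close> on all nonzero covariances have entered, and each further summand adds exactly \<open>v\<close>.\<close>

lemma var_S_linear: "n \<ge> m \<Longrightarrow> var_S n = var_S m + (real n - real m) * v"
proof (induction n rule: dec_induct)
  case (step n)
  have "(\<Sum>d=1..n. \<gamma> d) = (\<Sum>d\<in>{1..<m}. \<gamma> d)"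
    using step(1) \<gamma>_eq_0 by (intro sum.mono_neutral_right) auto
  then have "var_S (Suc n) = var_S n + v" by (simp add: var_S_Suc v_def)
  with step show ?case by (simp add: algebra_simps)
qed simp

lemma tendsto_var_S: "(\<lambda>n. var_S n / real n) \<longlonglongrightarrow> v"
proof (rule Lim_transform_eventually)
  show "\<forall>\<^sub>F n in sequentially. (var_S m - real m * v) * (1 / real n) + v = var_S n / real n"
    using eventually_ge_at_top[of m]
  proof eventually_elim
    case (elim n)
    then show ?case using m_pos by (subst var_S_linear[of n]) (simp_all add: field_simps)
  qed
  have "(\<lambda>n. (var_S m - real m * v) * (1 / real n) + v) \<longlonglongrightarrow> (var_S m - real m * v) * 0 + v"
    by (intro tendsto_intros lim_1_over_n)
  then show "(\<lambda>n. (var_S m - real m * v) * (1 / real n) + v) \<longlonglongrightarrow> v" by simp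
qed

lemma measurable_S_PiM: "S L \<in> borel_measurable (PiM {1..L + m} (\<lambda>_. D))"
  unfolding S_def X_def
  by (intro borel_measurable_sum borel_measurable_diff measurable_g_PiM borel_measurable_const) auto

lemma expectation_S: "expectation (\<lambda>\<omega>. S n (traj \<omega>)) = 0"
proof -
  have "expectation (\<lambda>\<omega>. X t (traj \<omega>)) = 0" "integrable M (\<lambda>\<omega>. X t (traj \<omega>))" if "t \<ge> 1" for t
  proof -
    have "integrable M (\<lambda>\<omega>. g t (traj \<omega>))"
      using that g_bounds by (intro integrable_bounded[of _ 1]) auto
    then show "expectation (\<lambda>\<omega>. X t (traj \<omega>)) = 0" "integrable M (\<lambda>\<omega>. X t (traj \<omega>))"
      using that by (simp_all add: X_def expectation_g prob_space)
  qed
  then show ?thesis by (simp add: S_def)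
qed

text \<open>The \<open>i\<close>-th block of length \<open>L\<close> after which \<open>m\<close> terms are left out. It is written as a function
  of the observations at the times \<open>i * (L + m) + 1, \<dots>, (i + 1) * (L + m)\<close>, so that different blocks use disjoint
  sets of observations and the same function.\<close>

definition "block_sum L i \<omega> = S L (\<lambda>j\<in>{1..L + m}. u (i * (L + m) + j) \<omega>)"

lemma block_sum_eq: "block_sum L i \<omega> = (\<Sum>t=1..L. X (i * (L + m) + t) (traj \<omega>))"
  unfolding block_sum_def S_def
proof (rule sum.cong[OF refl])
  fix t assume t: "t \<in> {1..L}"
  have "g t (\<lambda>j\<in>{1..L + m}. u (i * (L + m) + j) \<omega>) = g (i * (L + m) + t) (traj \<omega>)"
    unfolding g_def using t by (intro prod.cong) (simp_all add: add.assoc)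
  then show "X t (\<lambda>j\<in>{1..L + m}. u (i * (L + m) + j) \<omega>) = X (i * (L + m) + t) (traj \<omega>)"
    by (simp only: X_def)
qed

lemma distr_block_sum: "distr M borel (block_sum L i) = distr (PiM {1..L + m} (\<lambda>_. D)) borel (S L)"
proof -
  have "distr M borel (\<lambda>\<omega>. S L (\<lambda>j\<in>{1..L + m}. u (i * (L + m) + j) \<omega>)) = distr (PiM {1..L + m} (\<lambda>_. D)) borel (S L)"
    using m_pos by (intro distr_reindexed_fun measurable_S_PiM) (auto simp: inj_on_def)
  then show ?thesis unfolding block_sum_def[abs_def] .
qed

lemma indep_block_sums: "indep_vars (\<lambda>_. borel) (block_sum L) UNIV"
proof -
  have "indep_vars (\<lambda>_. borel) (\<lambda>i \<omega>. S L (\<lambda>j\<in>{1..L + m}. u (i * (L + m) + j) \<omega>)) UNIV"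
  proof (rule indep_blocks[of UNIV "\<lambda>i j. i * (L + m) + j" "\<lambda>_. {1..L + m}" "\<lambda>_. S L"])
    show "disjoint_family_on (\<lambda>i. (+) (i * (L + m)) ` {1..L + m}) UNIV"
    proof (unfold disjoint_family_on_def, intro ballI impI equals0I)
      fix i i' x assume ne: "i \<noteq> i'"
        and x: "x \<in> (+) (i * (L + m)) ` {1..L + m} \<inter> (+) (i' * (L + m)) ` {1..L + m}"
      have "(x - 1) div (L + m) = j" if "x \<in> (+) (j * (L + m)) ` {1..L + m}" for j
        using that by (intro div_block_index) auto
      note index = this
      have "i = i'"
        using index[OF IntD1[OF x]] index[OF IntD2[OF x]] by (rule trans[OF sym])
      with ne show False ..
    qed
  qed (use measurable_S_PiM in auto)
  then show ?thesis unfolding block_sum_def[abs_def] .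
qed

lemma rv_block_sum [measurable]: "random_variable borel (block_sum L i)"
  using indep_block_sums by (auto simp: indep_vars_def)

lemma block_sum_bound: "\<bar>block_sum L i \<omega>\<bar> \<le> real L"
  unfolding block_sum_def by (rule S_bound)

lemma block_sum_0: "block_sum L 0 \<omega> = S L (traj \<omega>)"
  by (simp add: block_sum_eq S_def)

lemma expectation_block_sum_fun:
  fixes f :: "real \<Rightarrow> real"
  assumes "f \<in> borel_measurable borel"
  shows "expectation (\<lambda>\<omega>. f (block_sum L i \<omega>)) = expectation (\<lambda>\<omega>. f (S L (traj \<omega>)))"
proof -
  have "expectation (\<lambda>\<omega>. f (block_sum L i \<omega>)) = integral\<^sup>L (distr M borel (block_sum L i)) f" for i
    by (rule integral_distr[OF rv_block_sum assms, symmetric])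
  then have "expectation (\<lambda>\<omega>. f (block_sum L i \<omega>)) = expectation (\<lambda>\<omega>. f (block_sum L 0 \<omega>))"
    by (simp only: distr_block_sum)
  then show ?thesis by (simp add: block_sum_0)
qed

text \<open>The terms left out are \<open>m\<close> per block and at most one incomplete block at the end. By \<open>m\<close>-dependence their
  sum has a second moment at most proportional to their number.\<close>

lemma S_minus_blocks:
  "expectation (\<lambda>\<omega>. (S n (traj \<omega>) - (\<Sum>i<n div (L + m). block_sum L i \<omega>))\<^sup>2)
    \<le> 2 * real m * (real (n div (L + m)) * real m + real (L + m))"
proof -
  let ?p = "L + m"
  let ?q = "n div ?p"
  let ?I = "\<lambda>i. {i * ?p + 1..i * ?p + L}"
  let ?U = "\<Union>i\<in>{..<?q}. ?I i"
  let ?G = "{1..n} - ?U"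
  have disj: "?I i \<inter> ?I j = {}" if "i \<noteq> j" for i j
  proof (rule equals0I)
    fix x assume x: "x \<in> ?I i \<inter> ?I j"
    have "(x - 1) div ?p = i" by (rule div_block_index) (use IntD1[OF x] in simp_all)
    moreover have "(x - 1) div ?p = j" by (rule div_block_index) (use IntD2[OF x] in simp_all)
    ultimately show False using that by simp
  qed
  have "i * ?p + L \<le> n" if "i < ?q" for i
  proof -
    have "Suc i * ?p \<le> ?q * ?p" using that by (intro mult_le_mono1) simp
    also have "\<dots> \<le> n" by simp
    finally show ?thesis by simp
  qed
  then have sub: "?U \<subseteq> {1..n}"
    by (intro UN_least) (auto intro: order_trans)
  have blocks: "(\<Sum>i<?q. block_sum L i \<omega>) = (\<Sum>t\<in>?U. X t (traj \<omega>))" for \<omega>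
  proof -
    have "(\<Sum>i<?q. block_sum L i \<omega>) = (\<Sum>i<?q. \<Sum>t\<in>?I i. X t (traj \<omega>))"
      unfolding block_sum_eq
      by (intro sum.cong refl sum.reindex_bij_witness[of _ "\<lambda>t. t - i * ?p" "\<lambda>t. i * ?p + t" for i]) auto
    also have "\<dots> = (\<Sum>t\<in>?U. X t (traj \<omega>))"
      using disj by (intro sum.UNION_disjoint[symmetric]) auto
    finally show ?thesis .
  qed
  have "S n (traj \<omega>) - (\<Sum>i<?q. block_sum L i \<omega>) = (\<Sum>t\<in>?G. X t (traj \<omega>))" for \<omega>
    unfolding S_def blocks using sub by (subst sum_diff) auto
  then have "expectation (\<lambda>\<omega>. (S n (traj \<omega>) - (\<Sum>i<?q. block_sum L i \<omega>))\<^sup>2)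
      = expectation (\<lambda>\<omega>. (\<Sum>t\<in>?G. X t (traj \<omega>))\<^sup>2)"
    by simp
  also have "\<dots> \<le> real (card ?G) * real (2 * m)"
    by (rule second_moment_sum_X_le) auto
  also have "\<dots> \<le> (real ?q * real m + real ?p) * real (2 * m)"
  proof (rule mult_right_mono)
    have "card ?U = (\<Sum>i<?q. card (?I i))"
      using disj by (intro card_UN_disjoint) auto
    then have U: "card ?U = ?q * L" by simp
    have "card ?G = card {1..n} - card ?U"
      using sub by (intro card_Diff_subset) simp_all
    then have "card ?G = n - ?q * L"
      by (simp only: U card_atLeastAtMost diff_Suc_1)
    moreover have "n = ?q * ?p + n mod ?p" by (rule div_mult_mod_eq[symmetric])
    moreover have "?q * ?p = ?q * L + ?q * m" by (rule distrib_left)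
    moreover have "n mod ?p \<le> ?p" using m_pos by (intro less_imp_le mod_less_divisor) simp
    ultimately have "card ?G \<le> ?q * m + ?p" by linarith
    then show "real (card ?G) \<le> real ?q * real m + real ?p"
      by (simp flip: of_nat_mult of_nat_add)
  qed simp
  finally show ?thesis by (simp add: mult_ac)
qed

text \<open>For a fixed block length \<open>L\<close> the i.i.d. central limit theorem applies to the block sums. The gaps have relative size
  \<open>m / (L + m)\<close>, and the variance of a block is \<open>L v\<close> up to a bounded error; so the squared mean-square distance between the normalised sum
  and the normalised block sum has a bound whose limit in \<open>n\<close> tends to 0 as \<open>L\<close> grows.\<close>

theorem clt_S:
  assumes nd: "c\<^sup>2 \<noteq> K"
  shows "weak_conv_m (\<lambda>n. distr M borel (\<lambda>\<omega>. S n (traj \<omega>) / sqrt (real n * v))) std_normal_distribution"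
proof (rule weak_conv_m_L2_approx)
  show "random_variable borel (\<lambda>\<omega>. S n (traj \<omega>) / sqrt (real n * v))" for n by measurable
  show "real_distribution std_normal_distribution" by (rule real_dist_normal_dist)
  fix \<delta> :: real assume \<delta>: "\<delta> > 0"
  have v: "v > 0" using nd by (rule v_pos)
  \<comment> \<open>the limit, as \<open>n\<close> grows, of the bound for the squared mean-square distance to the blocks of length \<open>L\<close>\<close>
  define err where "err L = 4 * (real m)\<^sup>2 / (real (L + m) * v) + 2 * (var_S L / (real (L + m) * v) - 1)\<^sup>2" for L
  have "err \<longlonglongrightarrow> 0"
  proof -
    have p: "(\<lambda>L. 1 / real (L + m)) \<longlonglongrightarrow> 0"
      by (rule LIMSEQ_ignore_initial_segment[OF lim_1_over_n])
    have "(\<lambda>L. real L * (1 / real (L + m))) \<longlonglongrightarrow> 1"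
    proof (rule Lim_transform_eventually)
      have "(\<lambda>L. 1 - real m * (1 / real (L + m))) \<longlonglongrightarrow> 1 - real m * 0"
        by (intro tendsto_intros p)
      then show "(\<lambda>L. 1 - real m * (1 / real (L + m))) \<longlonglongrightarrow> 1" by simp
      show "\<forall>\<^sub>F L in sequentially. 1 - real m * (1 / real (L + m)) = real L * (1 / real (L + m))"
        using m_pos by (intro always_eventually allI) (simp add: field_simps)
    qed
    then have "(\<lambda>L. 4 * (real m)\<^sup>2 / v * (1 / real (L + m))
        + 2 * (var_S L / real L * (real L * (1 / real (L + m))) / v - 1)\<^sup>2)
        \<longlonglongrightarrow> 4 * (real m)\<^sup>2 / v * 0 + 2 * (v * 1 / v - 1)\<^sup>2"
      using v by (intro tendsto_intros p tendsto_var_S) auto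
    moreover have "\<forall>\<^sub>F L in sequentially. 4 * (real m)\<^sup>2 / v * (1 / real (L + m))
        + 2 * (var_S L / real L * (real L * (1 / real (L + m))) / v - 1)\<^sup>2 = err L"
      using eventually_gt_at_top[of 0] by eventually_elim (simp add: err_def)
    ultimately show ?thesis using v by (auto intro: Lim_transform_eventually)
  qed
  then have "\<forall>\<^sub>F L in sequentially. err L < \<delta>"
    using \<delta> by (rule order_tendstoD)
  then have "\<forall>\<^sub>F L in sequentially. err L < \<delta> \<and> L \<ge> 1"
    using eventually_ge_at_top[of 1] by eventually_elim simp
  then obtain L where L: "err L < \<delta>" "L \<ge> 1"
    by (auto simp: eventually_sequentially)
  define p where "p = L + m"
  have p: "p \<ge> 1" using L by (simp add: p_def)
  have aL: "var_S L > 0" using var_S_pos[OF nd L(2)] .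
  let ?B = "\<lambda>q \<omega>. \<Sum>i<q. block_sum L i \<omega>"
  have mean: "expectation (block_sum L i) = 0" for i
    using expectation_block_sum_fun[of "\<lambda>x. x" L i] by (simp add: expectation_S)
  have sq: "expectation (\<lambda>\<omega>. (block_sum L i \<omega>)\<^sup>2) = var_S L" for i
    using expectation_block_sum_fun[of "\<lambda>x. x\<^sup>2" L i] by (simp add: var_S_def)
  have B2: "expectation (\<lambda>\<omega>. (?B q \<omega>)\<^sup>2) = real q * var_S L" for q
    by (rule second_moment_sum_indep[OF indep_block_sums block_sum_bound mean sq])
  have Bb: "\<bar>?B q \<omega>\<bar> \<le> real q * real L" for q \<omega>
  proof -
    have "\<bar>?B q \<omega>\<bar> \<le> (\<Sum>i<q. \<bar>block_sum L i \<omega>\<bar>)" by (rule sum_abs)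
    also have "\<dots> \<le> (\<Sum>i<q. real L)" by (intro sum_mono block_sum_bound)
    finally show ?thesis by simp
  qed
  have intB: "integrable M (\<lambda>\<omega>. (?B q \<omega>)\<^sup>2)" for q
    by (rule integrable_square_bounded[OF _ Bb]) measurable
  have blk_int: "integrable M (\<lambda>\<omega>. (block_sum L i \<omega>)\<^sup>2)" for i
    by (rule integrable_square_bounded[OF _ block_sum_bound]) measurable
  have intG: "integrable M (\<lambda>\<omega>. (S n (traj \<omega>) - ?B q \<omega>)\<^sup>2)" for n q :: nat
  proof (rule integrable_square_bounded)
    show "\<bar>S n (traj \<omega>) - ?B q \<omega>\<bar> \<le> real n + real q * real L" for \<omega>
    proof -
      have "\<bar>?B q \<omega>\<bar> \<le> real q * real L" by (rule Bb)
      then show ?thesis using S_bound[of n "traj \<omega>"] by linarith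
    qed
  qed measurable
  define W where "W n \<omega> = ?B (n div p) \<omega> / sqrt (real (n div p) * var_S L)" for n \<omega>
  show "\<exists>W. (\<forall>n. random_variable borel (W n)) \<and>
      weak_conv_m (\<lambda>n. distr M borel (W n)) std_normal_distribution \<and>
      (\<forall>\<^sub>F n in sequentially. integrable M (\<lambda>\<omega>. (S n (traj \<omega>) / sqrt (real n * v) - W n \<omega>)\<^sup>2) \<and>
         expectation (\<lambda>\<omega>. (S n (traj \<omega>) / sqrt (real n * v) - W n \<omega>)\<^sup>2) \<le> \<delta>)"
  proof (intro exI[of _ W] conjI allI)
    show "random_variable borel (W n)" for n unfolding W_def by measurable
    have "weak_conv_m (\<lambda>q. distr M borel (\<lambda>\<omega>. ?B q \<omega> / sqrt (real q * (sqrt (var_S L))\<^sup>2))) std_normal_distribution"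
      using aL mean sq blk_int
      by (intro central_limit_theorem_zero_mean[where \<mu> = "distr (PiM {1..L + m} (\<lambda>_. D)) borel (S L)"]
          indep_block_sums distr_block_sum) (simp_all add: mean)
    then have "weak_conv_m (\<lambda>q. distr M borel (\<lambda>\<omega>. ?B q \<omega> / sqrt (real q * var_S L))) std_normal_distribution"
      using aL by simp
    then show "weak_conv_m (\<lambda>n. distr M borel (W n)) std_normal_distribution"
      unfolding W_def[abs_def] using filterlim_div_at_top[OF p] by (rule weak_conv_m_filterlim)
    define e where "e n = 4 * real m * (real (n div p) / real n * real m + real p * (1 / real n)) / v
        + 2 * (real (n div p) / real n * var_S L / v - 1)\<^sup>2" for n
    have "e \<longlonglongrightarrow> 4 * real m * (1 / real p * real m + real p * 0) / v + 2 * (1 / real p * var_S L / v - 1)\<^sup>2"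
      unfolding e_def using v by (intro tendsto_intros tendsto_div_over_self p lim_1_over_n) auto
    also have "4 * real m * (1 / real p * real m + real p * 0) / v + 2 * (1 / real p * var_S L / v - 1)\<^sup>2 = err L"
      by (simp add: err_def p_def power2_eq_square mult_ac)
    finally have "\<forall>\<^sub>F n in sequentially. e n < \<delta>"
      using L(1) by (rule order_tendstoD)
    then show "\<forall>\<^sub>F n in sequentially. integrable M (\<lambda>\<omega>. (S n (traj \<omega>) / sqrt (real n * v) - W n \<omega>)\<^sup>2) \<and>
         expectation (\<lambda>\<omega>. (S n (traj \<omega>) / sqrt (real n * v) - W n \<omega>)\<^sup>2) \<le> \<delta>"
      using eventually_ge_at_top[of p]
    proof eventually_elim
      case (elim n)
      define q where "q = n div p"
      define \<alpha> where "\<alpha> = 1 / sqrt (real n * v)"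
      define \<beta> where "\<beta> = 1 / sqrt (real q * var_S L)"
      have n: "n \<ge> 1" and q: "q \<ge> 1"
        using elim p by (auto simp: q_def less_eq_div_iff_mult_less_eq)
      \<comment> \<open>the first part is the omitted terms, the second one the mismatch of the two normalisations\<close>
      have dec: "S n (traj \<omega>) / sqrt (real n * v) - W n \<omega>
          = \<alpha> * (S n (traj \<omega>) - ?B q \<omega>) + (\<alpha> - \<beta>) * ?B q \<omega>" for \<omega>
        by (simp add: W_def \<alpha>_def \<beta>_def q_def algebra_simps)
      have le: "(S n (traj \<omega>) / sqrt (real n * v) - W n \<omega>)\<^sup>2
          \<le> 2 * \<alpha>\<^sup>2 * (S n (traj \<omega>) - ?B q \<omega>)\<^sup>2 + 2 * (\<alpha> - \<beta>)\<^sup>2 * (?B q \<omega>)\<^sup>2" for \<omega>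
        unfolding dec
        using square_add_le[of "\<alpha> * (S n (traj \<omega>) - ?B q \<omega>)" "(\<alpha> - \<beta>) * ?B q \<omega>"]
        by (simp only: power_mult_distrib mult.assoc)
      have int: "integrable M (\<lambda>\<omega>. 2 * \<alpha>\<^sup>2 * (S n (traj \<omega>) - ?B q \<omega>)\<^sup>2 + 2 * (\<alpha> - \<beta>)\<^sup>2 * (?B q \<omega>)\<^sup>2)"
        by (intro Bochner_Integration.integrable_add integrable_mult_right intB intG)
      have int': "integrable M (\<lambda>\<omega>. (S n (traj \<omega>) / sqrt (real n * v) - W n \<omega>)\<^sup>2)"
      proof (rule Bochner_Integration.integrable_bound[OF int])
        show "random_variable borel (\<lambda>\<omega>. (S n (traj \<omega>) / sqrt (real n * v) - W n \<omega>)\<^sup>2)"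
          unfolding W_def by measurable
        show "AE \<omega> in M. norm ((S n (traj \<omega>) / sqrt (real n * v) - W n \<omega>)\<^sup>2)
          \<le> norm (2 * \<alpha>\<^sup>2 * (S n (traj \<omega>) - ?B q \<omega>)\<^sup>2 + 2 * (\<alpha> - \<beta>)\<^sup>2 * (?B q \<omega>)\<^sup>2)"
        proof (rule AE_I2)
          fix \<omega>
          show "norm ((S n (traj \<omega>) / sqrt (real n * v) - W n \<omega>)\<^sup>2)
            \<le> norm (2 * \<alpha>\<^sup>2 * (S n (traj \<omega>) - ?B q \<omega>)\<^sup>2 + 2 * (\<alpha> - \<beta>)\<^sup>2 * (?B q \<omega>)\<^sup>2)"
            unfolding real_norm_def abs_power2 using le[of \<omega>] by (rule order_trans) (rule abs_ge_self)
        qed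
      qed
      have "expectation (\<lambda>\<omega>. (S n (traj \<omega>) / sqrt (real n * v) - W n \<omega>)\<^sup>2)
          \<le> expectation (\<lambda>\<omega>. 2 * \<alpha>\<^sup>2 * (S n (traj \<omega>) - ?B q \<omega>)\<^sup>2 + 2 * (\<alpha> - \<beta>)\<^sup>2 * (?B q \<omega>)\<^sup>2)"
        using int' int le by (rule Bochner_Integration.integral_mono)
      also have "\<dots> = 2 * \<alpha>\<^sup>2 * expectation (\<lambda>\<omega>. (S n (traj \<omega>) - ?B q \<omega>)\<^sup>2)
          + 2 * (\<alpha> - \<beta>)\<^sup>2 * (real q * var_S L)"
        using intB[of q] intG[of n q] by (simp add: B2)
      also have "\<dots> \<le> 2 * \<alpha>\<^sup>2 * (2 * real m * (real q * real m + real p)) + 2 * (real q * var_S L / (real n * v) - 1)\<^sup>2"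
      proof (rule add_mono)
        show "2 * \<alpha>\<^sup>2 * expectation (\<lambda>\<omega>. (S n (traj \<omega>) - ?B q \<omega>)\<^sup>2)
            \<le> 2 * \<alpha>\<^sup>2 * (2 * real m * (real q * real m + real p))"
          using S_minus_blocks[where n = n and L = L] by (intro mult_left_mono) (auto simp: q_def p_def)
        have "(\<alpha> - \<beta>)\<^sup>2 * (real q * var_S L) = ((\<alpha> - \<beta>) * sqrt (real q * var_S L))\<^sup>2"
          using aL by (simp add: power_mult_distrib)
        also have "(\<alpha> - \<beta>) * sqrt (real q * var_S L) = sqrt (real q * var_S L / (real n * v)) - 1"
          using aL q by (simp add: \<alpha>_def \<beta>_def left_diff_distrib real_sqrt_divide)
        also have "(\<dots>)\<^sup>2 \<le> (real q * var_S L / (real n * v) - 1)\<^sup>2"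
          using aL v by (intro sqrt_minus_one_square_le) simp
        finally show "2 * (\<alpha> - \<beta>)\<^sup>2 * (real q * var_S L) \<le> 2 * (real q * var_S L / (real n * v) - 1)\<^sup>2"
          by simp
      qed
      also have "\<dots> = e n"
        using n v by (simp add: e_def \<alpha>_def q_def power_divide field_simps)
      finally show ?case using int' elim by simp
    qed
  qed
qed

end

section \<open>Expectation of the sum over all pairs\<close>

lemma sum_lag:
  fixes \<phi> :: "nat \<Rightarrow> real"
  shows "(\<Sum>t=1..n. \<Sum>s\<in>{t<..n}. \<phi> (s - t)) = (\<Sum>d=1..n. (real n - real d) * \<phi> d)"
proof (induction n)
  case (Suc n)
  have "(\<Sum>t=1..Suc n. \<Sum>s\<in>{t<..Suc n}. \<phi> (s - t)) = (\<Sum>t=1..n. \<Sum>s\<in>{t<..Suc n}. \<phi> (s - t))"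
    by simp
  also have "\<dots> = (\<Sum>t=1..n. \<phi> (Suc n - t) + (\<Sum>s\<in>{t<..n}. \<phi> (s - t)))"
  proof (rule sum.cong[OF refl])
    fix t assume "t \<in> {1..n}"
    then have "{t<..Suc n} = insert (Suc n) {t<..n}" by auto
    then show "(\<Sum>s\<in>{t<..Suc n}. \<phi> (s - t)) = \<phi> (Suc n - t) + (\<Sum>s\<in>{t<..n}. \<phi> (s - t))" by simp
  qed
  also have "\<dots> = (\<Sum>t=1..n. \<phi> (Suc n - t)) + (\<Sum>d=1..n. (real n - real d) * \<phi> d)"
    by (simp only: sum.distrib Suc.IH)
  also have "(\<Sum>t=1..n. \<phi> (Suc n - t)) = (\<Sum>d=1..n. \<phi> d)"
    by (rule sum.reindex_bij_witness[of _ "\<lambda>d. Suc n - d" "\<lambda>d. Suc n - d"]) auto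
  also have "(\<Sum>d=1..n. \<phi> d) + (\<Sum>d=1..n. (real n - real d) * \<phi> d) = (\<Sum>d=1..n. (real (Suc n) - real d) * \<phi> d)"
    by (simp add: algebra_simps flip: sum.distrib)
  finally show ?case by simp
qed simp

lemma sum_lag_tail:
  assumes "m \<le> n"
  shows "(\<Sum>d=m..n. real n - real d) = real ((Suc n - m) choose 2)"
  using assms
proof (induction n rule: dec_induct)
  case base
  then show ?case by (simp add: numeral_2_eq_2)
next
  case (step n)
  have "(\<Sum>d=m..Suc n. real (Suc n) - real d) = (\<Sum>d=m..n. 1 + (real n - real d))"
    using step(1) by (simp add: add_diff_eq)
  also have "\<dots> = real (Suc n - m) + real ((Suc n - m) choose 2)"
    unfolding sum.distrib step.IH by simp
  also have "\<dots> = real ((Suc (Suc n) - m) choose 2)"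
    using step(1) by (simp add: Suc_diff_le numeral_2_eq_2)
  finally show ?case .
qed

text \<open>The number of \<open>l\<close> with \<open>a + l * q < m\<close>, for a residue \<open>a < q\<close>.\<close>

definition chain_len :: "nat \<Rightarrow> nat \<Rightarrow> nat \<Rightarrow> nat" where
  "chain_len m q a = m div q + (if a < m mod q then 1 else 0)"

lemma chain_len_iff:
  assumes "a < q"
  shows "l < chain_len m q a \<longleftrightarrow> a + l * q < m"
proof -
  have m: "m = (m div q) * q + m mod q" by simp
  have i: "m mod q < q" using assms by simp
  consider "l < m div q" | "l = m div q" | "l > m div q" by linarith
  then show ?thesis
  proof cases
    case 1
    then have "Suc l * q \<le> (m div q) * q" by (intro mult_le_mono1) simp
    then have "a + l * q < m" using assms m unfolding mult_Suc by linarith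
    then show ?thesis using 1 by (simp add: chain_len_def)
  next
    case 2
    have "a + l * q < m \<longleftrightarrow> a < m mod q" using m unfolding 2 by linarith
    then show ?thesis using 2 by (simp add: chain_len_def)
  next
    case 3
    then have "Suc (m div q) * q \<le> l * q" by (intro mult_le_mono1) simp
    then have "\<not> a + l * q < m" using i m unfolding mult_Suc by linarith
    then show ?thesis using 3 by (simp add: chain_len_def)
  qed
qed

lemma prod_residue_classes:
  fixes f :: "nat \<Rightarrow> 'b::comm_monoid_mult"
  assumes q: "q \<ge> 1"
  shows "(\<Prod>j<m. f j) = (\<Prod>a<q. \<Prod>l<chain_len m q a. f (a + l * q))"
proof -
  have "(\<Prod>a<q. \<Prod>l<chain_len m q a. f (a + l * q))
      = (\<Prod>(a, l)\<in>(SIGMA a:{..<q}. {..<chain_len m q a}). f (a + l * q))"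
    by (rule prod.Sigma) simp_all
  also have "\<dots> = (\<Prod>j<m. f j)"
    by (rule prod.reindex_bij_witness[of _ "\<lambda>j. (j mod q, j div q)" "\<lambda>(a, l). a + l * q"])
       (use q in \<open>auto simp: chain_len_iff\<close>)
  finally show ?thesis by simp
qed

context kernel_process
begin

definition "chain l y = (\<Prod>j<l. k (y j) (y (Suc j)))"
definition "chain_prob l = (\<integral>y. chain l y \<partial>PiM {..l} (\<lambda>_. D))"

lemma chain_bounds: "0 \<le> chain l y" "chain l y \<le> 1"
  unfolding chain_def by (auto intro!: prod_nonneg prod_le_1 simp: k_nonneg k_le_1)

lemma measurable_chain: "chain l \<in> borel_measurable (PiM {..l} (\<lambda>_. D))"
proof -
  have [measurable]: "(\<lambda>y. y j) \<in> borel_measurable (PiM {..l} (\<lambda>_. D))" if "j \<le> l" for j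
    using that by (auto simp flip: measurable_cong_sets[OF refl sets_D] intro!: measurable_component_singleton)
  show ?thesis unfolding chain_def by (intro borel_measurable_prod) auto
qed

lemma integrable_chain: "integrable (PiM {..l} (\<lambda>_. D)) (chain l)"
proof -
  interpret P: prob_space "PiM {..l} (\<lambda>_. D)" by (rule prob_space_PiM_D)
  show ?thesis
    using chain_bounds by (intro P.integrable_const_bound[of _ 1] measurable_chain) auto
qed

lemma chain_prob_1: "chain_prob 1 = c"
proof -
  have I: "{..1::nat} = insert 0 {1}" by auto
  have "chain_prob 1 = (\<integral>x. (\<integral>y. chain 1 (x(0 := y)) \<partial>D) \<partial>PiM {1::nat} (\<lambda>_. D))"
    unfolding chain_prob_def I
    using integrable_chain[of 1] unfolding I by (intro PD.product_integral_insert) auto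
  also have "\<dots> = (\<integral>x. F (x 1) \<partial>PiM {1::nat} (\<lambda>_. D))"
  proof -
    have "chain 1 (x(0 := y)) = k y (x 1)" for x y
      by (simp add: chain_def)
    moreover have "(\<integral>y. k y z \<partial>D) = F z" for z
      by (simp add: F_def k_sym[of _ z])
    ultimately show ?thesis by (simp only:)
  qed
  also have "\<dots> = c"
    unfolding c_def by (rule PD.product_integral_singleton) measurable
  finally show ?thesis .
qed

text \<open>Given the middle observation of the chain the two comparisons are independent, and the conditional
  expectation of each is \<open>F\<close> at the middle observation.\<close>

lemma chain_prob_2: "chain_prob 2 = K"
proof -
  have I: "{..2::nat} = insert 2 (insert 0 {1})" by auto
  have ch: "chain 2 x = k (x 0) (x 1) * k (x 1) (x 2)" for x
    by (simp add: chain_def numeral_2_eq_2)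
  interpret P: prob_space "PiM (insert 0 {1::nat}) (\<lambda>_. D)" by (rule prob_space_PiM_D)
  have "chain_prob 2 = (\<integral>x. (\<integral>y. chain 2 (x(2 := y)) \<partial>D) \<partial>PiM (insert 0 {1::nat}) (\<lambda>_. D))"
    unfolding chain_prob_def I
    using integrable_chain[of 2] unfolding I by (intro PD.product_integral_insert) auto
  also have "\<dots> = (\<integral>x. k (x 0) (x 1) * F (x 1) \<partial>PiM (insert 0 {1::nat}) (\<lambda>_. D))"
  proof -
    have "chain 2 (x(2 := y)) = k (x 0) (x 1) * k (x 1) y" for x y
      by (simp add: ch)
    then show ?thesis by (simp add: F_def)
  qed
  also have "\<dots> = (\<integral>x. (\<integral>y. k ((x(0 := y)) 0) ((x(0 := y)) 1) * F ((x(0 := y)) 1) \<partial>D) \<partial>PiM {1::nat} (\<lambda>_. D))"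
  proof (rule PD.product_integral_insert)
    show "integrable (PiM (insert 0 {1::nat}) (\<lambda>_. D)) (\<lambda>x. k (x 0) (x 1) * F (x 1))"
    proof (rule P.integrable_const_bound[of _ 1])
      show "AE x in PiM (insert 0 {1::nat}) (\<lambda>_. D). norm (k (x 0) (x 1) * F (x 1)) \<le> 1"
        by (intro AE_I2) (simp add: k_nonneg k_le_1 F_nonneg F_le_1 abs_mult mult_le_one)
      have [measurable]: "(\<lambda>y. y j) \<in> borel_measurable (PiM (insert 0 {1::nat}) (\<lambda>_. D))" if "j \<in> insert 0 {1}" for j
        using that by (auto simp flip: measurable_cong_sets[OF refl sets_D] intro!: measurable_component_singleton)
      show "(\<lambda>x. k (x 0) (x 1) * F (x 1)) \<in> borel_measurable (PiM (insert 0 {1::nat}) (\<lambda>_. D))"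
        by measurable
    qed
  qed auto
  also have "\<dots> = (\<integral>x. (F (x 1))\<^sup>2 \<partial>PiM {1::nat} (\<lambda>_. D))"
  proof -
    have "(\<integral>y. k y z * F z \<partial>D) = (F z)\<^sup>2" for z
      by (simp add: F_def k_sym[of _ z] power2_eq_square)
    moreover have "(x(0 := y)) 1 = x 1" "(x(0 := y)) 0 = y" for x :: "nat \<Rightarrow> real" and y
      by simp_all
    ultimately show ?thesis by (simp only:)
  qed
  also have "\<dots> = K"
    unfolding K_def by (rule PD.product_integral_singleton) measurable
  finally show ?thesis .
qed

text \<open>The comparison of the windows at \<open>t\<close> and \<open>t + q\<close> links the times \<open>t + j\<close> and \<open>t + j + q\<close> for \<open>j < m\<close>. The links
  within one residue class modulo \<open>q\<close> form a chain, and different classes use different observations.\<close>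

lemma expectation_h_lag:
  assumes t: "t \<ge> 1" and q: "q \<ge> 1"
  shows "expectation (\<lambda>\<omega>. h t (t + q) (traj \<omega>))
    = chain_prob (Suc (m div q)) ^ (m mod q) * chain_prob (m div q) ^ (q - m mod q)"
proof -
  let ?f = "\<lambda>a l. t + a + l * q"
  let ?Y = "\<lambda>a \<omega>. chain (chain_len m q a) (\<lambda>l\<in>{..chain_len m q a}. u (?f a l) \<omega>)"
  have h: "h t (t + q) (traj \<omega>) = (\<Prod>a<q. ?Y a \<omega>)" for \<omega>
    unfolding h_def chain_def
  proof (subst prod_residue_classes[OF q, where m = m], intro prod.cong refl)
    fix a l assume "l \<in> {..<chain_len m q a}"
    moreover have "t + (a + l * q) = ?f a l" "t + q + (a + l * q) = ?f a (Suc l)" by simp_all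
    ultimately show "k (u (t + (a + l * q)) \<omega>) (u (t + q + (a + l * q)) \<omega>)
        = k ((\<lambda>l\<in>{..chain_len m q a}. u (?f a l) \<omega>) l) ((\<lambda>l\<in>{..chain_len m q a}. u (?f a l) \<omega>) (Suc l))"
      by (simp only: restrict_apply atMost_iff lessThan_iff less_imp_le Suc_le_eq if_True)
  qed
  have maps: "?f a \<in> {..chain_len m q a} \<rightarrow> {1..}" for a using t by auto
  have ind: "indep_vars (\<lambda>_. borel) ?Y {..<q}"
  proof (rule indep_blocks)
    show "disjoint_family_on (\<lambda>a. ?f a ` {..chain_len m q a}) {..<q}"
    proof (unfold disjoint_family_on_def, intro ballI impI equals0I)
      fix a a' x assume a: "a \<in> {..<q}" "a' \<in> {..<q}" "a \<noteq> a'"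
        and x: "x \<in> ?f a ` {..chain_len m q a} \<inter> ?f a' ` {..chain_len m q a'}"
      have "(x - t) mod q = a" using IntD1[OF x] a(1) by auto
      moreover have "(x - t) mod q = a'" using IntD2[OF x] a(2) by auto
      ultimately show False using a(3) by simp
    qed
  qed (use maps measurable_chain in auto)
  have E: "expectation (?Y a) = chain_prob (chain_len m q a)" for a
    unfolding chain_prob_def
    using q by (intro expectation_reindexed maps measurable_chain) (auto simp: inj_on_def)
  have int: "integrable M (?Y a)" for a
  proof (rule integrable_bounded[of _ 1])
    show "random_variable borel (?Y a)"
      using measurable_reindexed[OF maps] measurable_chain by (rule measurable_compose)
    show "\<bar>?Y a \<omega>\<bar> \<le> 1" for \<omega> using chain_bounds by simp
  qed
  have "expectation (\<lambda>\<omega>. h t (t + q) (traj \<omega>)) = (\<Prod>a<q. chain_prob (chain_len m q a))"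
    unfolding h using indep_vars_lebesgue_integral[OF _ ind] int E by simp
  also have "\<dots> = (\<Prod>a<q. if a < m mod q then chain_prob (Suc (m div q)) else chain_prob (m div q))"
    by (intro prod.cong refl) (simp add: chain_len_def)
  also have "\<dots> = chain_prob (Suc (m div q)) ^ (m mod q) * chain_prob (m div q) ^ (q - m mod q)"
  proof -
    have "m mod q < q" using q by simp
    then have "{..<q} \<inter> {a. a < m mod q} = {..<m mod q}" "{..<q} \<inter> - {a. a < m mod q} = {m mod q..<q}"
      by auto
    then show ?thesis by (subst prod.If_cases) simp_all
  qed
  finally show ?thesis .
qed

definition "pair_sum n x = (\<Sum>t=1..n. \<Sum>s\<in>{t<..n}. h t s x)"
definition "far_pair_sum n x = (\<Sum>t=1..n. \<Sum>s=t + m..n. h t s x)"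

lemma expectation_pair_sum:
  assumes n: "n \<ge> m"
  shows "expectation (\<lambda>\<omega>. pair_sum n (traj \<omega>))
    = (\<Sum>q=1..m - 1. (real n - real q) *
        (chain_prob (Suc (m div q)) ^ (m mod q) * chain_prob (m div q) ^ (q - m mod q)))
      + real ((Suc n - m) choose 2) * c ^ m"
proof -
  define \<phi> where "\<phi> q = (if q < m then chain_prob (Suc (m div q)) ^ (m mod q) * chain_prob (m div q) ^ (q - m mod q)
    else c ^ m)" for q
  have E: "expectation (\<lambda>\<omega>. h t s (traj \<omega>)) = \<phi> (s - t)" if "t \<ge> 1" "t < s" for t s
  proof (cases "s - t < m")
    case True
    then show ?thesis using expectation_h_lag[of t "s - t"] that by (simp add: \<phi>_def)
  next
    case False
    then show ?thesis using expectation_h_far[of t s] that by (simp add: \<phi>_def far_def)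
  qed
  have int: "integrable M (\<lambda>\<omega>. h t s (traj \<omega>))" if "t \<ge> 1" "t < s" for t s
    using that h_bounds by (intro integrable_bounded[of _ 1]) auto
  have "expectation (\<lambda>\<omega>. pair_sum n (traj \<omega>)) = (\<Sum>t=1..n. expectation (\<lambda>\<omega>. \<Sum>s\<in>{t<..n}. h t s (traj \<omega>)))"
    unfolding pair_sum_def by (intro Bochner_Integration.integral_sum Bochner_Integration.integrable_sum int) auto
  also have "\<dots> = (\<Sum>t=1..n. \<Sum>s\<in>{t<..n}. \<phi> (s - t))"
  proof (rule sum.cong[OF refl])
    fix t assume t: "t \<in> {1..n}"
    have "expectation (\<lambda>\<omega>. \<Sum>s\<in>{t<..n}. h t s (traj \<omega>)) = (\<Sum>s\<in>{t<..n}. expectation (\<lambda>\<omega>. h t s (traj \<omega>)))"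
      using t by (intro Bochner_Integration.integral_sum int) auto
    also have "\<dots> = (\<Sum>s\<in>{t<..n}. \<phi> (s - t))"
      using t by (intro sum.cong refl E) auto
    finally show "expectation (\<lambda>\<omega>. \<Sum>s\<in>{t<..n}. h t s (traj \<omega>)) = (\<Sum>s\<in>{t<..n}. \<phi> (s - t))" .
  qed
  also have "\<dots> = (\<Sum>d=1..n. (real n - real d) * \<phi> d)" by (rule sum_lag)
  also have "{1..n} = {1..m - 1} \<union> {m..n}" using n m_pos by auto
  also have "(\<Sum>d\<in>\<dots>. (real n - real d) * \<phi> d)
      = (\<Sum>d=1..m - 1. (real n - real d) * \<phi> d) + (\<Sum>d=m..n. (real n - real d) * \<phi> d)"
    using m_pos by (intro sum.union_disjoint) auto
  also have "(\<Sum>d=m..n. (real n - real d) * \<phi> d) = (\<Sum>d=m..n. real n - real d) * c ^ m"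
    by (simp add: \<phi>_def sum_distrib_right)
  also have "(\<Sum>d=m..n. real n - real d) = real ((Suc n - m) choose 2)"
    using n by (rule sum_lag_tail)
  also have "(\<Sum>d=1..m - 1. (real n - real d) * \<phi> d) = (\<Sum>q=1..m - 1. (real n - real q) *
        (chain_prob (Suc (m div q)) ^ (m mod q) * chain_prob (m div q) ^ (q - m mod q)))"
    by (intro sum.cong refl) (auto simp: \<phi>_def)
  finally show ?thesis .
qed

text \<open>\<open>far_pairs\<close> consists of ordered pairs, so it contains each distant pair twice.\<close>

lemma far_pair_sum_eq: "2 * far_pair_sum n x = far_sum n x + real (card (far_pairs n)) * c ^ m"
proof -
  let ?A = "SIGMA t:{1..n}. {t + m..n}"
  have split: "far_pairs n = ?A \<union> prod.swap ` ?A"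
  proof (intro equalityI subsetI)
    fix p assume p: "p \<in> far_pairs n"
    obtain a b where [simp]: "p = (a, b)" by (cases p)
    have "(a, b) \<in> ?A \<or> (b, a) \<in> ?A" using p by (auto simp: far_pairs_def far_def)
    then show "p \<in> ?A \<union> prod.swap ` ?A"
    proof
      assume "(b, a) \<in> ?A"
      then have "prod.swap (b, a) \<in> prod.swap ` ?A" by (rule imageI)
      then show ?thesis by simp
    qed simp
  qed (auto simp: far_pairs_def far_def)
  have "(\<Sum>(a, b)\<in>far_pairs n. h a b x) = (\<Sum>(a, b)\<in>?A. h a b x) + (\<Sum>(a, b)\<in>prod.swap ` ?A. h a b x)"
    unfolding split using m_pos by (intro sum.union_disjoint) auto
  also have "(\<Sum>(a, b)\<in>prod.swap ` ?A. h a b x) = (\<Sum>(a, b)\<in>?A. h a b x)"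
    by (subst sum.reindex) (auto simp: h_sym intro!: sum.cong)
  also have "(\<Sum>(a, b)\<in>?A. h a b x) = far_pair_sum n x"
    unfolding far_pair_sum_def by (rule sum.Sigma[symmetric]) auto
  finally have "(\<Sum>(a, b)\<in>far_pairs n. h a b x) = 2 * far_pair_sum n x" by simp
  moreover have "far_sum n x = (\<Sum>(a, b)\<in>far_pairs n. h a b x) - real (card (far_pairs n)) * c ^ m"
    unfolding far_sum_def by (simp add: case_prod_unfold sum_subtractf)
  ultimately show ?thesis by simp
qed

lemma pair_sum_minus_far_bounds:
  "0 \<le> pair_sum n x - far_pair_sum n x" "pair_sum n x - far_pair_sum n x \<le> 2 * real m * real n"
proof -
  have eq: "pair_sum n x - far_pair_sum n x = (\<Sum>t=1..n. \<Sum>s\<in>{t<..n} \<inter> near t. h t s x)"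
  proof -
    have "(\<Sum>s\<in>{t<..n}. h t s x) = (\<Sum>s\<in>{t<..n} \<inter> near t. h t s x) + (\<Sum>s=t + m..n. h t s x)" for t
    proof -
      have "{t<..n} - near t = {t + m..n}" using m_pos by (auto simp: near_def far_def)
      then show ?thesis using sum.Int_Diff[of "{t<..n}" "\<lambda>s. h t s x" "near t"] by simp
    qed
    then show ?thesis by (simp add: pair_sum_def far_pair_sum_def sum.distrib)
  qed
  show "0 \<le> pair_sum n x - far_pair_sum n x"
    unfolding eq by (intro sum_nonneg h_bounds)
  have "(\<Sum>t=1..n. \<Sum>s\<in>{t<..n} \<inter> near t. h t s x) \<le> (\<Sum>t=1..n. 2 * real m)"
  proof (rule sum_mono)
    fix t
    have "(\<Sum>s\<in>{t<..n} \<inter> near t. h t s x) \<le> (\<Sum>s\<in>{t<..n} \<inter> near t. 1)"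
      by (intro sum_mono h_bounds)
    also have "\<dots> \<le> 2 * real m"
    proof -
      have "card ({t<..n} \<inter> near t) \<le> card (near t)" by (intro card_mono finite_near) auto
      then show ?thesis using card_near[of t] by simp
    qed
    finally show "(\<Sum>s\<in>{t<..n} \<inter> near t. h t s x) \<le> 2 * real m" .
  qed
  also have "\<dots> = 2 * real m * real n" by simp
  finally show "pair_sum n x - far_pair_sum n x \<le> 2 * real m * real n" unfolding eq .
qed

end

section \<open>Asymptotic normality of the sum over all pairs\<close>

lemma real_choose_two: "real (n choose 2) = real n * (real n - 1) / 2"
  by (cases n) (simp_all add: choose_two real_of_nat_div algebra_simps)

context kernel_process
begin

lemma far_sum_diff_bound: "\<bar>far_sum n x - 2 * real n * S n x\<bar> \<le> 3 * real n * real n"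
proof -
  have "\<bar>2 * real n * S n x\<bar> \<le> 2 * real n * real n"
    unfolding abs_mult using S_bound[of n x] by (simp add: mult_left_mono)
  then show ?thesis using far_sum_bound[of n x] by simp
qed

lemma integrable_far_sum_squares:
  "integrable M (\<lambda>\<omega>. (far_sum n (traj \<omega>))\<^sup>2)"
  "integrable M (\<lambda>\<omega>. (far_sum n (traj \<omega>) - 2 * real n * S n (traj \<omega>))\<^sup>2)"
  by (rule integrable_square_bounded[OF _ far_sum_bound], measurable)
     (rule integrable_square_bounded[OF _ far_sum_diff_bound], measurable)

text \<open>By \<open>far_sum_projection\<close> the second moment is that of \<open>2 n S n\<close>, which is \<open>4 n\<^sup>2 E (S n)\<^sup>2\<close>, up to an error of
  smaller order. Taking \<open>\<eta> = 1 / sqrt n\<close> in \<open>second_moment_perturb\<close> makes both error terms vanish relative to \<open>n\<^sup>3\<close>.\<close>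

lemma tendsto_far_sum_second_moment:
  "(\<lambda>n. expectation (\<lambda>\<omega>. (far_sum n (traj \<omega>))\<^sup>2) / real n ^ 3) \<longlonglongrightarrow> 4 * v"
proof -
  let ?E = "\<lambda>n. expectation (\<lambda>\<omega>. (far_sum n (traj \<omega>))\<^sup>2)"
  define b where "b n = 1 / sqrt (real n) * (4 * (var_S n / real n)) + (1 + sqrt (real n)) * 160 * (real m)\<^sup>2 * (1 / real n)" for n
  have "(\<lambda>n. ?E n / real n ^ 3 - 4 * (var_S n / real n)) \<longlonglongrightarrow> 0"
  proof (rule Lim_null_comparison)
    show "\<forall>\<^sub>F n in sequentially. norm (?E n / real n ^ 3 - 4 * (var_S n / real n)) \<le> b n"
      using eventually_gt_at_top[of 0]
    proof eventually_elim
      case (elim n)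
      then have n: "real n > 0" by simp
      have E2: "expectation (\<lambda>\<omega>. (2 * real n * S n (traj \<omega>))\<^sup>2) = 4 * (real n)\<^sup>2 * var_S n"
        by (simp add: var_S_def power_mult_distrib)
      have "\<bar>?E n - 4 * (real n)\<^sup>2 * var_S n\<bar> \<le> 1 / sqrt (real n) * (4 * (real n)\<^sup>2 * var_S n)
          + (1 + 1 / (1 / sqrt (real n))) * expectation (\<lambda>\<omega>. (far_sum n (traj \<omega>) - 2 * real n * S n (traj \<omega>))\<^sup>2)"
        unfolding E2[symmetric] using n integrable_S_square[of n]
        by (intro second_moment_perturb integrable_far_sum_squares) (auto simp: power_mult_distrib)
      also have "\<dots> \<le> 1 / sqrt (real n) * (4 * (real n)\<^sup>2 * var_S n) + (1 + sqrt (real n)) * (160 * (real m * real n)\<^sup>2)"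
        using far_sum_projection[of n] by (simp only: divide_divide_eq_right mult_1 div_by_1)
          (intro add_left_mono mult_left_mono; simp)
      also have "\<dots> = b n * real n ^ 3"
        using n by (simp add: b_def power_mult_distrib power2_eq_square power3_eq_cube field_simps)
      finally have "\<bar>?E n - 4 * (real n)\<^sup>2 * var_S n\<bar> / real n ^ 3 \<le> b n"
        using n by (simp add: pos_divide_le_eq)
      moreover have "?E n / real n ^ 3 - 4 * (var_S n / real n) = (?E n - 4 * (real n)\<^sup>2 * var_S n) / real n ^ 3"
        using n by (simp add: field_simps power2_eq_square power3_eq_cube)
      ultimately show ?case using n by simp
    qed
    have l1: "(\<lambda>n. 1 / sqrt (real n)) \<longlonglongrightarrow> 0" by real_asymp
    have l2: "(\<lambda>n. (1 + sqrt (real n)) * 160 * (real m)\<^sup>2 * (1 / real n)) \<longlonglongrightarrow> 0" by real_asymp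
    have "b \<longlonglongrightarrow> 0 * (4 * v) + 0"
      unfolding b_def by (intro tendsto_intros l1 l2 tendsto_var_S)
    then show "b \<longlonglongrightarrow> 0" by simp
  qed
  then have "(\<lambda>n. (?E n / real n ^ 3 - 4 * (var_S n / real n)) + 4 * (var_S n / real n)) \<longlonglongrightarrow> 0 + 4 * v"
    by (intro tendsto_intros tendsto_var_S)
  then show ?thesis by simp
qed

lemma rv_far_pair_sum [measurable]: "random_variable borel (\<lambda>\<omega>. far_pair_sum n (traj \<omega>))"
  unfolding far_pair_sum_def by (intro borel_measurable_sum rv_h) auto

lemma rv_pair_sum [measurable]: "random_variable borel (\<lambda>\<omega>. pair_sum n (traj \<omega>))"
  unfolding pair_sum_def by (intro borel_measurable_sum rv_h) auto

lemma integrable_far_sum: "integrable M (\<lambda>\<omega>. far_sum n (traj \<omega>))"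
  by (rule integrable_bounded[OF _ far_sum_bound]) measurable

lemma far_pair_sum_conv: "far_pair_sum n x = far_sum n x / 2 + real (card (far_pairs n)) * c ^ m / 2"
  using far_pair_sum_eq[of n x] by simp

lemma integrable_far_pair_sum: "integrable M (\<lambda>\<omega>. far_pair_sum n (traj \<omega>))"
  unfolding far_pair_sum_conv using integrable_far_sum by simp

lemma far_pair_sum_centred:
  "far_pair_sum n (traj \<omega>) - expectation (\<lambda>\<omega>. far_pair_sum n (traj \<omega>)) = far_sum n (traj \<omega>) / 2"
  unfolding far_pair_sum_conv using integrable_far_sum[of n]
  by (simp add: expectation_far_sum prob_space)

lemma variance_far_pair_sum:
  "variance (\<lambda>\<omega>. b * far_pair_sum n (traj \<omega>)) = b\<^sup>2 / 4 * expectation (\<lambda>\<omega>. (far_sum n (traj \<omega>))\<^sup>2)"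
proof -
  have "b * far_pair_sum n (traj \<omega>) - expectation (\<lambda>\<omega>. b * far_pair_sum n (traj \<omega>)) = b / 2 * far_sum n (traj \<omega>)" for \<omega>
    using far_pair_sum_centred[of n \<omega>] by (simp add: right_diff_distrib[symmetric])
  then show ?thesis by (simp only:) (simp add: power_mult_distrib power_divide)
qed

lemma pair_sum_projection:
  "integrable M (\<lambda>\<omega>. (2 * (pair_sum n (traj \<omega>) - expectation (\<lambda>\<omega>. pair_sum n (traj \<omega>))) - 2 * real n * S n (traj \<omega>))\<^sup>2)"
  "expectation (\<lambda>\<omega>. (2 * (pair_sum n (traj \<omega>) - expectation (\<lambda>\<omega>. pair_sum n (traj \<omega>))) - 2 * real n * S n (traj \<omega>))\<^sup>2)
    \<le> 352 * (real m * real n)\<^sup>2"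
proof -
  define r where "r \<omega> = pair_sum n (traj \<omega>) - far_pair_sum n (traj \<omega>)" for \<omega>
  have [measurable]: "random_variable borel r" unfolding r_def by measurable
  have r: "0 \<le> r \<omega>" "r \<omega> \<le> 2 * real m * real n" for \<omega>
    using pair_sum_minus_far_bounds[of n "traj \<omega>"] by (simp_all add: r_def)
  have int_r: "integrable M r"
    using r by (intro integrable_bounded[of _ "2 * real m * real n"]) auto
  have Er: "0 \<le> expectation r" "expectation r \<le> 2 * real m * real n"
    using r int_r by (auto intro!: Bochner_Integration.integral_nonneg integral_le_const)
  have rb: "\<bar>2 * (r \<omega> - expectation r)\<bar> \<le> 4 * real m * real n" for \<omega>
    using r[of \<omega>] Er by (simp add: abs_mult)
  have "pair_sum n (traj \<omega>) = far_pair_sum n (traj \<omega>) + r \<omega>" for \<omega>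
    by (simp add: r_def)
  moreover from this have "expectation (\<lambda>\<omega>. pair_sum n (traj \<omega>)) = expectation (\<lambda>\<omega>. far_pair_sum n (traj \<omega>)) + expectation r"
    using integrable_far_pair_sum int_r by simp
  ultimately have eq: "2 * (pair_sum n (traj \<omega>) - expectation (\<lambda>\<omega>. pair_sum n (traj \<omega>))) - 2 * real n * S n (traj \<omega>)
      = (far_sum n (traj \<omega>) - 2 * real n * S n (traj \<omega>)) + 2 * (r \<omega> - expectation r)" for \<omega>
    using far_pair_sum_centred[of n \<omega>] by simp
  let ?d = "\<lambda>\<omega>. far_sum n (traj \<omega>) - 2 * real n * S n (traj \<omega>)"
  show int: "integrable M (\<lambda>\<omega>. (2 * (pair_sum n (traj \<omega>) - expectation (\<lambda>\<omega>. pair_sum n (traj \<omega>))) - 2 * real n * S n (traj \<omega>))\<^sup>2)"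
    unfolding eq
  proof (rule integrable_square_bounded)
    show "\<bar>?d \<omega> + 2 * (r \<omega> - expectation r)\<bar> \<le> 3 * real n * real n + 4 * real m * real n" for \<omega>
      using far_sum_diff_bound[of n "traj \<omega>"] rb[of \<omega>] by linarith
  qed measurable
  have "expectation (\<lambda>\<omega>. (2 * (pair_sum n (traj \<omega>) - expectation (\<lambda>\<omega>. pair_sum n (traj \<omega>))) - 2 * real n * S n (traj \<omega>))\<^sup>2)
      \<le> expectation (\<lambda>\<omega>. 2 * (?d \<omega>)\<^sup>2 + 2 * (4 * real m * real n)\<^sup>2)"
  proof (rule Bochner_Integration.integral_mono[OF int])
    show "integrable M (\<lambda>\<omega>. 2 * (?d \<omega>)\<^sup>2 + 2 * (4 * real m * real n)\<^sup>2)"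
      using integrable_far_sum_squares(2)[of n] by simp
    fix \<omega>
    have "(2 * (r \<omega> - expectation r))\<^sup>2 \<le> (4 * real m * real n)\<^sup>2"
      using rb[of \<omega>] by (intro power2_le_iff_abs_le[THEN iffD2]) auto
    with square_add_le[of "?d \<omega>" "2 * (r \<omega> - expectation r)"]
    show "(2 * (pair_sum n (traj \<omega>) - expectation (\<lambda>\<omega>. pair_sum n (traj \<omega>))) - 2 * real n * S n (traj \<omega>))\<^sup>2
      \<le> 2 * (?d \<omega>)\<^sup>2 + 2 * (4 * real m * real n)\<^sup>2"
      unfolding eq by linarith
  qed
  also have "\<dots> = 2 * expectation (\<lambda>\<omega>. (?d \<omega>)\<^sup>2) + 2 * (4 * real m * real n)\<^sup>2"
    using integrable_far_sum_squares(2)[of n] by (simp add: prob_space)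
  also have "\<dots> \<le> 2 * (160 * (real m * real n)\<^sup>2) + 2 * (4 * real m * real n)\<^sup>2"
    using far_sum_projection[of n] by simp
  also have "\<dots> = 352 * (real m * real n)\<^sup>2" by (simp add: power2_eq_square)
  finally show "expectation (\<lambda>\<omega>. (2 * (pair_sum n (traj \<omega>) - expectation (\<lambda>\<omega>. pair_sum n (traj \<omega>))) - 2 * real n * S n (traj \<omega>))\<^sup>2)
    \<le> 352 * (real m * real n)\<^sup>2" .
qed

text \<open>The normalisation is any sequence \<open>s2\<close> asymptotic to \<open>4 v / n\<close>: with \<open>N = n (n - 1) / 2\<close> pairs the centred mean over
  pairs is close to \<open>2 n S n / (2 N)\<close>, that is to \<open>2 S n / n\<close>, whose variance is about \<open>4 v / n\<close>.\<close>

theorem clt_pair_sum: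
  assumes nd: "c\<^sup>2 \<noteq> K"
    and s2: "(\<lambda>n. real n * s2 n) \<longlonglongrightarrow> 4 * v"
  shows "weak_conv_m (\<lambda>n. distr M borel (\<lambda>\<omega>.
      (1 / real (n choose 2) * pair_sum n (traj \<omega>) - 1 / real (n choose 2) * expectation (\<lambda>\<omega>. pair_sum n (traj \<omega>))) / sqrt (s2 n)))
    std_normal_distribution"
proof (rule weak_conv_m_L2_approx)
  define N where "N n = real (n choose 2)" for n
  have N: "N n = real n * (real n - 1) / 2" for n
    unfolding N_def by (rule real_choose_two)
  let ?P = "\<lambda>n \<omega>. pair_sum n (traj \<omega>) - expectation (\<lambda>\<omega>. pair_sum n (traj \<omega>))"
  let ?Z = "\<lambda>n \<omega>. (1 / real (n choose 2) * pair_sum n (traj \<omega>) - 1 / real (n choose 2) * expectation (\<lambda>\<omega>. pair_sum n (traj \<omega>))) / sqrt (s2 n)"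
  let ?W = "\<lambda>n \<omega>. S n (traj \<omega>) / sqrt (real n * v)"
  show "random_variable borel (?Z n)" for n by measurable
  show "real_distribution std_normal_distribution" by (rule real_dist_normal_dist)
  fix \<delta> :: real assume \<delta>: "\<delta> > 0"
  have v: "v > 0" using nd by (rule v_pos)
  define e where "e n = 2 * (real n ^ 4 / (N n)\<^sup>2 * v / (real n * s2 n) - 1)\<^sup>2 * (var_S n / real n / v)
      + 176 * (real m)\<^sup>2 * (real n ^ 3 / (N n)\<^sup>2) / (real n * s2 n)" for n
  have "e \<longlonglongrightarrow> 2 * (4 * v / (4 * v) - 1)\<^sup>2 * (v / v) + 176 * (real m)\<^sup>2 * 0 / (4 * v)"
  proof -
    have l1: "(\<lambda>n. real n ^ 4 / (N n)\<^sup>2) \<longlonglongrightarrow> 4"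
      unfolding N by real_asymp (simp add: power2_eq_square)
    have l2: "(\<lambda>n. real n ^ 3 / (N n)\<^sup>2) \<longlonglongrightarrow> 0" unfolding N by real_asymp
    show ?thesis
      unfolding e_def using v by (intro tendsto_intros l1 l2 s2 tendsto_var_S) auto
  qed
  then have "e \<longlonglongrightarrow> 0" using v by simp
  then have "\<forall>\<^sub>F n in sequentially. e n < \<delta>" using \<delta> by (rule order_tendstoD)
  moreover have "\<forall>\<^sub>F n in sequentially. real n * s2 n > 0"
    by (rule order_tendstoD(1)[OF s2]) (use v in simp)
  ultimately have ev: "\<forall>\<^sub>F n in sequentially. integrable M (\<lambda>\<omega>. (?Z n \<omega> - ?W n \<omega>)\<^sup>2) \<and>
           expectation (\<lambda>\<omega>. (?Z n \<omega> - ?W n \<omega>)\<^sup>2) \<le> \<delta>"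
    using eventually_ge_at_top[of 2]
  proof eventually_elim
    case (elim n)
    then have n: "real n \<ge> 2" by simp
    have s: "s2 n > 0" using elim(2) n by (simp add: zero_less_mult_iff)
    have Npos: "N n > 0" unfolding N using n by simp
    define \<alpha> where "\<alpha> = 1 / (2 * N n * sqrt (s2 n))"
    define \<beta> where "\<beta> = 1 / sqrt (real n * v)"
    let ?d = "\<lambda>\<omega>. 2 * ?P n \<omega> - 2 * real n * S n (traj \<omega>)"
    have Z: "?Z n \<omega> = 2 * \<alpha> * ?P n \<omega>" for \<omega>
      unfolding N_def[symmetric] \<alpha>_def by (simp add: diff_divide_distrib right_diff_distrib)
    \<comment> \<open>the first part is the projection error, the second one the mismatch of the two normalisations\<close>
    have dec: "?Z n \<omega> - ?W n \<omega> = \<alpha> * ?d \<omega> + (2 * \<alpha> * real n - \<beta>) * S n (traj \<omega>)" for \<omega>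
      unfolding Z \<beta>_def by (simp add: algebra_simps)
    have le: "(?Z n \<omega> - ?W n \<omega>)\<^sup>2 \<le> 2 * \<alpha>\<^sup>2 * (?d \<omega>)\<^sup>2 + 2 * (2 * \<alpha> * real n - \<beta>)\<^sup>2 * (S n (traj \<omega>))\<^sup>2" for \<omega>
      unfolding dec
      using square_add_le[of "\<alpha> * ?d \<omega>" "(2 * \<alpha> * real n - \<beta>) * S n (traj \<omega>)"]
      by (simp only: power_mult_distrib mult.assoc)
    have int: "integrable M (\<lambda>\<omega>. 2 * \<alpha>\<^sup>2 * (?d \<omega>)\<^sup>2 + 2 * (2 * \<alpha> * real n - \<beta>)\<^sup>2 * (S n (traj \<omega>))\<^sup>2)"
      by (intro Bochner_Integration.integrable_add integrable_mult_right pair_sum_projection integrable_S_square)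
    have int': "integrable M (\<lambda>\<omega>. (?Z n \<omega> - ?W n \<omega>)\<^sup>2)"
    proof (rule Bochner_Integration.integrable_bound[OF int])
      show "random_variable borel (\<lambda>\<omega>. (?Z n \<omega> - ?W n \<omega>)\<^sup>2)" by measurable
      show "AE \<omega> in M. norm ((?Z n \<omega> - ?W n \<omega>)\<^sup>2)
          \<le> norm (2 * \<alpha>\<^sup>2 * (?d \<omega>)\<^sup>2 + 2 * (2 * \<alpha> * real n - \<beta>)\<^sup>2 * (S n (traj \<omega>))\<^sup>2)"
      proof (rule AE_I2)
        fix \<omega>
        show "norm ((?Z n \<omega> - ?W n \<omega>)\<^sup>2)
          \<le> norm (2 * \<alpha>\<^sup>2 * (?d \<omega>)\<^sup>2 + 2 * (2 * \<alpha> * real n - \<beta>)\<^sup>2 * (S n (traj \<omega>))\<^sup>2)"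
          unfolding real_norm_def abs_power2 using le[of \<omega>] by (rule order_trans) (rule abs_ge_self)
      qed
    qed
    have "expectation (\<lambda>\<omega>. (?Z n \<omega> - ?W n \<omega>)\<^sup>2)
        \<le> expectation (\<lambda>\<omega>. 2 * \<alpha>\<^sup>2 * (?d \<omega>)\<^sup>2 + 2 * (2 * \<alpha> * real n - \<beta>)\<^sup>2 * (S n (traj \<omega>))\<^sup>2)"
      using int' int le by (rule Bochner_Integration.integral_mono)
    also have "\<dots> = 2 * \<alpha>\<^sup>2 * expectation (\<lambda>\<omega>. (?d \<omega>)\<^sup>2) + 2 * (2 * \<alpha> * real n - \<beta>)\<^sup>2 * var_S n"
      using pair_sum_projection(1)[of n] integrable_S_square[of n] by (simp add: var_S_def)
    also have "\<dots> \<le> 2 * \<alpha>\<^sup>2 * (352 * (real m * real n)\<^sup>2) + 2 * ((real n ^ 4 / (N n)\<^sup>2 * v / (real n * s2 n) - 1)\<^sup>2 * (var_S n / real n / v))"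
    proof (rule add_mono)
      show "2 * \<alpha>\<^sup>2 * expectation (\<lambda>\<omega>. (?d \<omega>)\<^sup>2) \<le> 2 * \<alpha>\<^sup>2 * (352 * (real m * real n)\<^sup>2)"
        by (intro mult_left_mono pair_sum_projection) simp
      have a0: "var_S n \<ge> 0" unfolding var_S_def by (intro Bochner_Integration.integral_nonneg) simp
      have nv: "real n * v > 0" using n v by simp
      have "2 * \<alpha> * real n - \<beta> = (sqrt (real n ^ 4 / (N n)\<^sup>2 * v / (real n * s2 n)) - 1) * \<beta>"
      proof -
        have "real n ^ 4 / (N n)\<^sup>2 * v / (real n * s2 n) = (real n / N n)\<^sup>2 * (real n * v) / s2 n"
          using n s Npos by (simp add: power_divide field_simps power2_eq_square power4_eq_xxxx)
        then have "sqrt (real n ^ 4 / (N n)\<^sup>2 * v / (real n * s2 n)) = real n / N n * sqrt (real n * v) / sqrt (s2 n)"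
          using n Npos by (simp only: real_sqrt_divide real_sqrt_mult real_sqrt_abs) simp
        moreover have "real n / N n * sqrt (real n * v) / sqrt (s2 n) * \<beta> = 2 * \<alpha> * real n"
          using n v s Npos by (simp add: \<alpha>_def \<beta>_def)
        ultimately show ?thesis by (simp add: left_diff_distrib)
      qed
      then have "(2 * \<alpha> * real n - \<beta>)\<^sup>2 * var_S n
          = (sqrt (real n ^ 4 / (N n)\<^sup>2 * v / (real n * s2 n)) - 1)\<^sup>2 * (\<beta>\<^sup>2 * var_S n)"
        by (simp only: power_mult_distrib mult.assoc)
      also have "\<beta>\<^sup>2 * var_S n = var_S n / real n / v"
        using nv by (simp add: \<beta>_def power_divide)
      also have "(sqrt (real n ^ 4 / (N n)\<^sup>2 * v / (real n * s2 n)) - 1)\<^sup>2 * (var_S n / real n / v)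
          \<le> (real n ^ 4 / (N n)\<^sup>2 * v / (real n * s2 n) - 1)\<^sup>2 * (var_S n / real n / v)"
        using a0 n v s by (intro mult_right_mono sqrt_minus_one_square_le) auto
      finally show "2 * (2 * \<alpha> * real n - \<beta>)\<^sup>2 * var_S n
          \<le> 2 * ((real n ^ 4 / (N n)\<^sup>2 * v / (real n * s2 n) - 1)\<^sup>2 * (var_S n / real n / v))"
        by simp
    qed
    also have "2 * \<alpha>\<^sup>2 * (352 * (real m * real n)\<^sup>2) = 176 * (real m)\<^sup>2 * (real n ^ 3 / (N n)\<^sup>2) / (real n * s2 n)"
      using n s Npos by (simp add: \<alpha>_def power_divide power_mult_distrib field_simps power2_eq_square power3_eq_cube)
    finally show ?case using int' elim by (simp add: e_def mult.assoc add.commute)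
  qed
  show "\<exists>W. (\<forall>n. random_variable borel (W n)) \<and>
      weak_conv_m (\<lambda>n. distr M borel (W n)) std_normal_distribution \<and>
      (\<forall>\<^sub>F n in sequentially. integrable M (\<lambda>\<omega>. (?Z n \<omega> - W n \<omega>)\<^sup>2) \<and>
         expectation (\<lambda>\<omega>. (?Z n \<omega> - W n \<omega>)\<^sup>2) \<le> \<delta>)"
  proof (intro exI[of _ ?W] conjI allI)
    show "random_variable borel (?W n)" for n by measurable
  qed (rule clt_S[OF nd], rule ev)
qed

end

section \<open>The correlation integral\<close>

lemma close_vec_eq_prod:
  assumes "m \<ge> 1"
  shows "close_vec m \<epsilon> x t s = (\<Prod>j<m. Ind \<epsilon> \<bar>x (t + j) - x (s + j)\<bar>)"
proof -
  have "max_norm m (\<lambda>j. delay_vec x t j - delay_vec x s j) < \<epsilon> \<longleftrightarrow> (\<forall>j<m. \<bar>x (t + j) - x (s + j)\<bar> < \<epsilon>)"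
    unfolding max_norm_def delay_vec_def using assms
    by (subst Max_less_iff) (auto simp: lessThan_empty_iff)
  moreover have "(\<Prod>j<m. Ind \<epsilon> \<bar>x (t + j) - x (s + j)\<bar>) = (if \<forall>j<m. \<bar>x (t + j) - x (s + j)\<bar> < \<epsilon> then 1 else 0)"
    by (auto simp: Ind_def indicator_def)
  ultimately show ?thesis
    by (simp add: close_vec_def Ind_def indicator_def)
qed

text \<open>With superscript 0 no condition involves the second process, and the chain depends only on the first
  \<open>l + 1\<close> coordinates of the first one.\<close>

lemma (in kernel_process) omega_eq_chain_prob:
  assumes k: "\<And>x y. k x y = Ind \<epsilon> \<bar>x - y\<bar>"
  shows "omega D \<epsilon> l 0 = chain_prob l"
proof -
  let ?P = "PiM (UNIV :: nat set) (\<lambda>_. D)"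
  let ?r = "\<lambda>p :: (nat \<Rightarrow> real) \<times> (nat \<Rightarrow> real). restrict (fst p) {..l}"
  have r1: "(\<lambda>x. restrict x {..l}) \<in> ?P \<rightarrow>\<^sub>M PiM {..l} (\<lambda>_. D)"
    by (rule measurable_restrict_subset) simp
  have law: "distr (iid_pair D) (PiM {..l} (\<lambda>_. D)) ?r = PiM {..l} (\<lambda>_. D)"
  proof -
    have "distr (iid_pair D) (PiM {..l} (\<lambda>_. D)) ((\<lambda>x. restrict x {..l}) \<circ> fst)
        = distr (distr (iid_pair D) ?P fst) (PiM {..l} (\<lambda>_. D)) (\<lambda>x. restrict x {..l})"
      by (rule distr_distr[symmetric, OF r1 measurable_fst])
    also have "\<dots> = PiM {..l} (\<lambda>_. D)"
      by (simp add: prob_space.distr_pair_fst[OF prob_space_PiM_D] PD.distr_PiM_restrict_finite)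
    finally show ?thesis by (simp add: comp_def)
  qed
  let ?A = "{p \<in> space (iid_pair D). (\<forall>j<l. \<bar>fst p j - fst p (j + 1)\<bar> < \<epsilon>) \<and>
         (\<forall>j\<in>{1..0}. \<bar>fst p (l + j - 0) - snd p j\<bar> < \<epsilon>)}"
  have ind: "indicator ?A p = chain l (?r p)" if "p \<in> space (iid_pair D)" for p
  proof -
    have "chain l (?r p) = (\<Prod>j<l. Ind \<epsilon> \<bar>fst p j - fst p (Suc j)\<bar>)"
      unfolding chain_def k by (intro prod.cong refl) simp
    also have "\<dots> = (if \<forall>j<l. \<bar>fst p j - fst p (Suc j)\<bar> < \<epsilon> then 1 else 0)"
      by (auto simp: Ind_def indicator_def)
    finally show ?thesis using that by (simp add: indicator_def)
  qed
  have "omega D \<epsilon> l 0 = measure (iid_pair D) (?A \<inter> space (iid_pair D))"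
    unfolding omega_def by (rule arg_cong[of _ _ "measure (iid_pair D)"]) auto
  also have "\<dots> = (\<integral>p. indicator ?A p \<partial>iid_pair D)"
    by (rule Bochner_Integration.integral_indicator[symmetric])
  also have "\<dots> = (\<integral>p. chain l (?r p) \<partial>iid_pair D)"
    by (rule Bochner_Integration.integral_cong[OF refl ind])
  also have "\<dots> = (\<integral>y. chain l y \<partial>distr (iid_pair D) (PiM {..l} (\<lambda>_. D)) ?r)"
    by (rule integral_distr[symmetric, OF measurable_compose[OF measurable_fst r1] measurable_chain])
  also have "\<dots> = chain_prob l"
    by (simp add: law chain_prob_def)
  finally show ?thesis .
qed

lemma W_0:
  assumes "q \<ge> 1"
  shows "W D \<epsilon> m q 0 = omega D \<epsilon> (Suc (m div q)) 0 ^ (m mod q) * omega D \<epsilon> (m div q) 0 ^ (q - m mod q)"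
  using assms by (simp add: W_def Let_def Ind_def minus_div_mult_eq_mod)

text \<open>For fixed \<open>q\<close> the bracket multiplied by \<open>M_weight T m q\<close> does not depend on \<open>T\<close>; the weight is quadratic in \<open>T\<close>, while
  \<open>(num_pairs m T)\<^sup>2\<close> has degree four.\<close>

lemma tendsto_sigma_breve2: "(\<lambda>T. real T * sigma_breve2 D \<epsilon> m T) \<longlonglongrightarrow> 0"
proof -
  define C where "C q = (let i = m - (m div q) * q in
           2 * (\<Sum>d = 1..m. W D \<epsilon> m q d - W D \<epsilon> m q 0 * W D \<epsilon> m m 0)
           + (1 - Ind 0 (real q - 2 * real i)) *
               ((\<Sum>d = 1..i. U D \<epsilon> m q d)
                + (real q - 2 * real i) * U D \<epsilon> m q i
                + (\<Sum>d = q - i + 1..q - 1. U D \<epsilon> m q (q - d)))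
           + Ind 0 (real q - 2 * real i) *
               ((\<Sum>d = 1..q - i. U D \<epsilon> m q d)
                + (2 * real i - real q) * U D \<epsilon> m q (q - i)
                + (\<Sum>d = i + 1..q - 1. U D \<epsilon> m q (q - d))))" for q
  have lim: "(\<lambda>T. real T * (2 / (num_pairs m T)\<^sup>2) * M_weight T m q) \<longlonglongrightarrow> 0" for q
  proof (rule Lim_transform_eventually)
    show "\<forall>\<^sub>F T in sequentially.
        real T * (2 / ((real T + 1 - real m) * (real T - real m) / 2)\<^sup>2) *
          ((real T - 4 * real m - real q + 3) * (real T - 4 * real m - real q + 4))
        = real T * (2 / (num_pairs m T)\<^sup>2) * M_weight T m q"
      using eventually_ge_at_top[of m]
    proof eventually_elim
      case (elim T)
      then have "num_pairs m T = (real T + 1 - real m) * (real T - real m) / 2"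
        by (simp add: num_pairs_def num_vec_def real_choose_two of_nat_diff algebra_simps)
      then show ?case by (simp only: M_weight_def)
    qed
    show "(\<lambda>T. real T * (2 / ((real T + 1 - real m) * (real T - real m) / 2)\<^sup>2) *
          ((real T - 4 * real m - real q + 3) * (real T - 4 * real m - real q + 4))) \<longlonglongrightarrow> 0"
      by real_asymp
  qed
  have "(\<lambda>T. \<Sum>q=1..m - 1. real T * (2 / (num_pairs m T)\<^sup>2) * M_weight T m q * C q) \<longlonglongrightarrow> (\<Sum>q=1..m - 1. 0 * C q)"
    by (intro tendsto_sum tendsto_mult_right lim)
  moreover have "(\<Sum>q=1..m - 1. real T * (2 / (num_pairs m T)\<^sup>2) * M_weight T m q * C q) = real T * sigma_breve2 D \<epsilon> m T" for T
    unfolding sigma_breve2_def C_def[symmetric] by (simp add: sum_distrib_left mult.assoc)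
  ultimately show ?thesis by simp
qed

theorem theorem3p1:
  fixes M :: "'a measure" and u :: "nat \<Rightarrow> 'a \<Rightarrow> real"
    and \<epsilon> :: real and m :: nat and D :: "real measure"
    and sigma_tilde2 :: "nat \<Rightarrow> real"
  assumes "prob_space M"
    and eps: "\<epsilon> > 0"
    and m: "m \<ge> 1"
    and indep: "prob_space.indep_vars M (\<lambda>_. borel) u {1..}"
    and ident: "\<And>t. t \<ge> 1 \<Longrightarrow> distr M borel (u t) = D"
    and nondegenerate: "omega D \<epsilon> 2 0 \<noteq> (omega D \<epsilon> 1 0)\<^sup>2"
    and sigma_tilde2:
      "(\<lambda>T. prob_space.variance M (\<lambda>x. corr_int0 m \<epsilon> T (\<lambda>t. u t x)) - sigma_tilde2 T)
         \<in> O(\<lambda>T. 1 / real T ^ 3)"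
  shows "(\<forall>T\<ge>2 * m. prob_space.expectation M (\<lambda>x. corr_int m \<epsilon> T (\<lambda>t. u t x)) = mu D \<epsilon> m T) \<and>
    weak_conv_m
      (\<lambda>T. distr M borel
         (\<lambda>x. (corr_int m \<epsilon> T (\<lambda>t. u t x) - mu D \<epsilon> m T) / sqrt (sigma2 D \<epsilon> m sigma_tilde2 T)))
      std_normal_distribution"
proof -
  define k where "k = (\<lambda>x y. Ind \<epsilon> \<bar>x - y\<bar>)"
  interpret prob_space M by fact
  interpret kernel_process M u D k m
  proof unfold_locales
    show "case_prod k \<in> borel_measurable (borel \<Otimes>\<^sub>M borel)"
      unfolding k_def Ind_def by measurable
    show "k x y = k y x" for x y by (simp add: k_def abs_minus_commute)
    show "0 \<le> k x y" "k x y \<le> 1" for x y by (simp_all add: k_def Ind_def indicator_def)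
  qed (fact indep ident m)+
  have om: "omega D \<epsilon> l 0 = chain_prob l" for l
    by (rule omega_eq_chain_prob) (simp add: k_def)
  have nd: "c\<^sup>2 \<noteq> K"
    using nondegenerate using chain_prob_1 by (auto simp: om chain_prob_2)
  have v: "v > 0" using nd by (rule v_pos)
  let ?n = "\<lambda>T. num_vec m T"
  have close: "close_vec m \<epsilon> x t s = h t s x" for x t s
    unfolding close_vec_eq_prod[OF m] h_def by (simp add: k_def)
  have C: "corr_int m \<epsilon> T x = 1 / real (?n T choose 2) * pair_sum (?n T) x" for T x
    by (simp add: corr_int_def num_pairs_def pair_sum_def close)
  have C0: "corr_int0 m \<epsilon> T x = 1 / num_pairs0 m T * far_pair_sum (?n T) x" for T x
  proof -
    have "(\<Sum>t=1..?n T - m. \<Sum>s=t + m..?n T. h t s x) = (\<Sum>t=1..?n T. \<Sum>s=t + m..?n T. h t s x)"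
      by (rule sum.mono_neutral_left) auto
    then show ?thesis by (simp add: corr_int0_def far_pair_sum_def close)
  qed
  have W0: "W D \<epsilon> m q 0 = chain_prob (Suc (m div q)) ^ (m mod q) * chain_prob (m div q) ^ (q - m mod q)" if "q \<ge> 1" for q
    using W_0[OF that, of D \<epsilon> m] by (simp add: om)
  have mean: "mu D \<epsilon> m T = 1 / real (?n T choose 2) * expectation (\<lambda>\<omega>. pair_sum (?n T) (traj \<omega>))" if T: "T \<ge> 2 * m" for T
  proof -
    have "m \<le> ?n T" using T m by (simp add: num_vec_def)
    from expectation_pair_sum[OF this]
    have E: "expectation (\<lambda>\<omega>. pair_sum (?n T) (traj \<omega>))
        = (\<Sum>q=1..m - 1. (real (?n T) - real q) * W D \<epsilon> m q 0) + num_pairs0 m T * W D \<epsilon> m m 0"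
      using m chain_prob_1 by (simp add: W0 num_pairs0_def)
    show ?thesis unfolding E mu_def num_pairs_def by (simp add: distrib_left)
  qed
  have part1: "expectation (\<lambda>x. corr_int m \<epsilon> T (\<lambda>t. u t x)) = mu D \<epsilon> m T" if "T \<ge> 2 * m" for T
    by (simp add: C mean[OF that])
  have n_lim: "filterlim ?n at_top sequentially"
    unfolding filterlim_at_top
  proof
    fix Z show "\<forall>\<^sub>F T in sequentially. Z \<le> ?n T"
      using eventually_ge_at_top[of "Z + m"] by eventually_elim (simp add: num_vec_def)
  qed
  have n_real: "real (?n T) = real T + 1 - real m" if "T \<ge> m" for T
    using that by (simp add: num_vec_def of_nat_diff)
  have N_real: "num_pairs m T = (real T + 1 - real m) * (real T - real m) / 2" if "T \<ge> m" for T
    using that by (simp add: num_pairs_def num_vec_def real_choose_two of_nat_diff algebra_simps)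
  have N0_real: "num_pairs0 m T = (real T + 2 - 2 * real m) * (real T + 1 - 2 * real m) / 2" if "T \<ge> 2 * m" for T
    using that by (simp add: num_pairs0_def num_vec_def real_choose_two of_nat_diff algebra_simps)
  have var_lim: "(\<lambda>T. real T * variance (\<lambda>\<omega>. corr_int0 m \<epsilon> T (traj \<omega>))) \<longlonglongrightarrow> 4 * v"
  proof (rule Lim_transform_eventually)
    let ?N0 = "\<lambda>T. (real T + 2 - 2 * real m) * (real T + 1 - 2 * real m) / 2"
    let ?E = "\<lambda>n. expectation (\<lambda>\<omega>. (far_sum n (traj \<omega>))\<^sup>2) / real n ^ 3"
    have l: "(\<lambda>T. real T * (real T + 1 - real m) ^ 3 / (4 * (?N0 T)\<^sup>2)) \<longlonglongrightarrow> 1"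
      by real_asymp (simp add: power2_eq_square)
    have "(\<lambda>T. real T * (real T + 1 - real m) ^ 3 / (4 * (?N0 T)\<^sup>2) * ?E (?n T)) \<longlonglongrightarrow> 1 * (4 * v)"
      by (intro tendsto_mult l filterlim_compose[OF tendsto_far_sum_second_moment n_lim])
    then show "(\<lambda>T. real T * (real T + 1 - real m) ^ 3 / (4 * (?N0 T)\<^sup>2) * ?E (?n T)) \<longlonglongrightarrow> 4 * v"
      by simp
    show "\<forall>\<^sub>F T in sequentially. real T * (real T + 1 - real m) ^ 3 / (4 * (?N0 T)\<^sup>2) * ?E (?n T)
        = real T * variance (\<lambda>\<omega>. corr_int0 m \<epsilon> T (traj \<omega>))"
      using eventually_ge_at_top[of "2 * m"]
    proof eventually_elim
      case (elim T)
      have "variance (\<lambda>\<omega>. corr_int0 m \<epsilon> T (traj \<omega>))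
          = (1 / ?N0 T)\<^sup>2 / 4 * expectation (\<lambda>\<omega>. (far_sum (?n T) (traj \<omega>))\<^sup>2)"
        unfolding C0 N0_real[OF elim] by (rule variance_far_pair_sum)
      moreover have "real (?n T) = real T + 1 - real m" "real T + 1 - real m > 0"
        using n_real[of T] elim by simp_all
      ultimately show ?case by (simp add: power_divide)
    qed
  qed
  have st_lim: "(\<lambda>T. real T * sigma_tilde2 T) \<longlonglongrightarrow> 4 * v"
  proof -
    let ?d = "\<lambda>T. variance (\<lambda>\<omega>. corr_int0 m \<epsilon> T (traj \<omega>)) - sigma_tilde2 T"
    have "(\<lambda>T. real T * ?d T) \<in> O(\<lambda>T. real T * (1 / real T ^ 3))"
      using sigma_tilde2 by (intro landau_o.big.mult) auto
    also have "(\<lambda>T. real T * (1 / real T ^ 3)) \<in> o(\<lambda>_. 1)" by real_asymp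
    finally have "(\<lambda>T. real T * ?d T) \<longlonglongrightarrow> 0" by (rule smalloD_tendsto[of _ _ "\<lambda>_. 1", simplified])
    then have "(\<lambda>T. real T * variance (\<lambda>\<omega>. corr_int0 m \<epsilon> T (traj \<omega>)) - real T * ?d T) \<longlonglongrightarrow> 4 * v - 0"
      by (intro tendsto_intros var_lim)
    then show ?thesis by (simp add: algebra_simps)
  qed
  have s_lim: "(\<lambda>T. real T * sigma2 D \<epsilon> m sigma_tilde2 T) \<longlonglongrightarrow> 4 * v"
  proof -
    have "(\<lambda>T. ((real T + 2 - 2 * real m) * (real T + 1 - 2 * real m) / 2) / ((real T + 1 - real m) * (real T - real m) / 2)) \<longlonglongrightarrow> 1"
      by real_asymp
    then have "(\<lambda>T. num_pairs0 m T / num_pairs m T) \<longlonglongrightarrow> 1"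
    proof (rule Lim_transform_eventually)
      show "\<forall>\<^sub>F T in sequentially. ((real T + 2 - 2 * real m) * (real T + 1 - 2 * real m) / 2) / ((real T + 1 - real m) * (real T - real m) / 2)
          = num_pairs0 m T / num_pairs m T"
        using eventually_ge_at_top[of "2 * m"] by eventually_elim (simp add: N0_real N_real)
    qed
    then have "(\<lambda>T. real T * sigma_breve2 D \<epsilon> m T + (num_pairs0 m T / num_pairs m T)\<^sup>2 * (real T * sigma_tilde2 T))
        \<longlonglongrightarrow> 0 + 1\<^sup>2 * (4 * v)"
      by (intro tendsto_intros tendsto_sigma_breve2 st_lim)
    then show ?thesis by (simp add: sigma2_def algebra_simps)
  qed
  \<comment> \<open>\<open>T = n + m - 1\<close> is the sample size with \<open>n\<close> delay vectors\<close>
  define s2 where "s2 n = sigma2 D \<epsilon> m sigma_tilde2 (n + m - 1)" for n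
  have s2_lim: "(\<lambda>n. real n * s2 n) \<longlonglongrightarrow> 4 * v"
  proof (rule Lim_transform_eventually)
    have sh: "filterlim (\<lambda>n. n + m - 1) at_top sequentially"
      unfolding filterlim_at_top
    proof
      fix Z show "\<forall>\<^sub>F n in sequentially. Z \<le> n + m - 1"
        using eventually_ge_at_top[of Z] by eventually_elim (use m in simp)
    qed
    have l: "(\<lambda>n. real n / (real n + real m - 1)) \<longlonglongrightarrow> 1" by real_asymp
    have "(\<lambda>n. real n / (real n + real m - 1) * (real (n + m - 1) * s2 n)) \<longlonglongrightarrow> 1 * (4 * v)"
      unfolding s2_def by (intro tendsto_mult l filterlim_compose[OF s_lim sh])
    then show "(\<lambda>n. real n / (real n + real m - 1) * (real (n + m - 1) * s2 n)) \<longlonglongrightarrow> 4 * v" by simp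
    show "\<forall>\<^sub>F n in sequentially. real n / (real n + real m - 1) * (real (n + m - 1) * s2 n) = real n * s2 n"
      using eventually_ge_at_top[of 1]
    proof eventually_elim
      case (elim n)
      then have "real (n + m - 1) = real n + real m - 1" "real n + real m - 1 > 0"
        using m by (simp_all add: of_nat_diff)
      then show ?case by simp
    qed
  qed
  let ?Z = "\<lambda>n \<omega>. (1 / real (n choose 2) * pair_sum n (traj \<omega>) - 1 / real (n choose 2) * expectation (\<lambda>\<omega>. pair_sum n (traj \<omega>))) / sqrt (s2 n)"
  have "weak_conv_m (\<lambda>T. distr M borel (?Z (?n T))) std_normal_distribution"
    by (rule weak_conv_m_filterlim[OF clt_pair_sum[OF nd s2_lim] n_lim])
  then have "weak_conv_m (\<lambda>T. distr M borel
         (\<lambda>x. (corr_int m \<epsilon> T (\<lambda>t. u t x) - mu D \<epsilon> m T) / sqrt (sigma2 D \<epsilon> m sigma_tilde2 T)))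
      std_normal_distribution"
  proof (rule weak_conv_m_cong_eventually)
    show "\<forall>\<^sub>F T in sequentially. distr M borel (?Z (?n T)) = distr M borel
        (\<lambda>x. (corr_int m \<epsilon> T (\<lambda>t. u t x) - mu D \<epsilon> m T) / sqrt (sigma2 D \<epsilon> m sigma_tilde2 T))"
      using eventually_ge_at_top[of "2 * m"]
    proof eventually_elim
      case (elim T)
      have "?n T + m - 1 = T" using elim m by (simp add: num_vec_def)
      then show ?case by (simp add: C mean[OF elim] s2_def)
    qed
  qed
  with part1 show ?thesis by simp
qed

end
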